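(* Let $\{k_p\}_{p\ge1}$ be a strictly increasing sequence of positive integers, and for each $N$ let $\mathbf{X}=\mathbf{V}\mathbf{V}^*$ where $\mathbf{V}$ is the $N\times N$ generalized random Vandermonde matrix associated with $\{k_p\}$. Assume that for every $r\ge1$ and every partition $\rho\in\mathcal{P}(r)$ the limit $$K_\rho=\lim_{N\to\infty}\frac{|S_{\rho,N}|}{N^{r+1-|\rho|}}$$ exists. Then $0\le K_\rho\le1$ for all $\rho$, the limits $m_r=\lim_{N\to\infty}\mathbb{E}\big(\mathrm{tr}_N(\mathbf{X}^r)\big)$ exist for all $r\ge0$ and satisfy $$m_r=\sum_{\rho\in\mathcal{P}(r)}K_\rho\quad(r\ge1),$$ and there exists a unique probability measure $\mu$ supported on $[0,\infty)$ with $m_r=\int_0^\infty t^r\,d\mu(t)$ for all $r$.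
   Context: Generalized random Vandermonde matrix: with $\theta_1,\ldots,\theta_N$ i.i.d. uniform on $[0,1]$ and $z_q=e^{2\pi i\theta_q}$, $V(p,q)=\frac{1}{\sqrt N}z_q^{k_p}$ for $p,q=1,\ldots,N$ (the case $k_p=p-1$ is the usual Vandermonde matrix). $\mathrm{tr}_N=\frac1N\mathrm{Tr}$. $\mathcal{P}(r)$ is the set of partitions of $\{1,\ldots,r\}$, $|\rho|$ is the number of blocks of $\rho$. For $\rho$ with blocks $B_1,\ldots,B_{|\rho|}$, $$S_{\rho,N}=\Big\{(p_1,\ldots,p_r)\in\{1,\ldots,N\}^r:\ \sum_{i\in B_j}k_{p_i}=\sum_{i\in B_j}k_{p_{i+1}}\ \text{for all } j\Big\},$$ with the convention $p_{r+1}=p_1$. *)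

theory Defs
  imports "HOL-Probability.Probability" "HOL-Library.Disjoint_Sets"
begin

text \<open>Square matrices of size N are represented as functions nat => nat => complex,
  indexed by 1..N.\<close>

definition mat_mult :: "nat \<Rightarrow> (nat \<Rightarrow> nat \<Rightarrow> complex) \<Rightarrow> (nat \<Rightarrow> nat \<Rightarrow> complex) \<Rightarrow> (nat \<Rightarrow> nat \<Rightarrow> complex)" where
  "mat_mult N A B = (\<lambda>i j. \<Sum>l = 1..N. A i l * B l j)"

definition mat_id :: "nat \<Rightarrow> nat \<Rightarrow> complex" where
  "mat_id = (\<lambda>i j. if i = j then 1 else 0)"

fun mat_pow :: "nat \<Rightarrow> (nat \<Rightarrow> nat \<Rightarrow> complex) \<Rightarrow> nat \<Rightarrow> (nat \<Rightarrow> nat \<Rightarrow> complex)" where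
  "mat_pow N A 0 = mat_id"
| "mat_pow N A (Suc r) = mat_mult N (mat_pow N A r) A"

definition mat_adj :: "(nat \<Rightarrow> nat \<Rightarrow> complex) \<Rightarrow> (nat \<Rightarrow> nat \<Rightarrow> complex)" where
  "mat_adj A = (\<lambda>i j. cnj (A j i))"

definition ntrace :: "nat \<Rightarrow> (nat \<Rightarrow> nat \<Rightarrow> complex) \<Rightarrow> complex" where
  "ntrace N A = (\<Sum>p = 1..N. A p p) / of_nat N"

definition vandermonde :: "(nat \<Rightarrow> nat) \<Rightarrow> nat \<Rightarrow> (nat \<Rightarrow> real) \<Rightarrow> (nat \<Rightarrow> nat \<Rightarrow> complex)" where
  "vandermonde k N \<theta> = (\<lambda>p q. (cis (2 * pi * \<theta> q)) ^ (k p) / complex_of_real (sqrt (real N)))"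

definition vandermonde_X :: "(nat \<Rightarrow> nat) \<Rightarrow> nat \<Rightarrow> (nat \<Rightarrow> real) \<Rightarrow> (nat \<Rightarrow> nat \<Rightarrow> complex)" where
  "vandermonde_X k N \<theta> = mat_mult N (vandermonde k N \<theta>) (mat_adj (vandermonde k N \<theta>))"

definition theta_law :: "nat \<Rightarrow> (nat \<Rightarrow> real) measure" where
  "theta_law N = PiM {1..N} (\<lambda>_. uniform_measure lborel {0..1})"

definition expected_moment :: "(nat \<Rightarrow> nat) \<Rightarrow> nat \<Rightarrow> nat \<Rightarrow> complex" where
  "expected_moment k N r = (LINT \<theta>|theta_law N. ntrace N (mat_pow N (vandermonde_X k N \<theta>) r))"

definition cyc_next :: "nat \<Rightarrow> nat \<Rightarrow> nat" where
  "cyc_next r i = (if i = r then 1 else i + 1)"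

definition partitions :: "nat \<Rightarrow> nat set set set" where
  "partitions r = {\<rho>. partition_on {1..r} \<rho>}"

definition S_set :: "(nat \<Rightarrow> nat) \<Rightarrow> nat \<Rightarrow> nat set set \<Rightarrow> nat \<Rightarrow> (nat \<Rightarrow> nat) set" where
  "S_set k r \<rho> N = {p \<in> {1..r} \<rightarrow>\<^sub>E {1..N}.
      \<forall>B\<in>\<rho>. (\<Sum>i\<in>B. k (p i)) = (\<Sum>i\<in>B. k (p (cyc_next r i)))}"

definition K_seq :: "(nat \<Rightarrow> nat) \<Rightarrow> nat \<Rightarrow> nat set set \<Rightarrow> nat \<Rightarrow> real" where
  "K_seq k r \<rho> N = real (card (S_set k r \<rho> N)) / real N ^ (r + 1 - card \<rho>)"

definition K_lim :: "(nat \<Rightarrow> nat) \<Rightarrow> nat \<Rightarrow> nat set set \<Rightarrow> real" where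
  "K_lim k r \<rho> = lim (K_seq k r \<rho>)"

end

theory Submission
  imports Defs "Jordan_Normal_Form.Schur_Decomposition"
begin

text \<open>
  Expanding the trace over row indices \<open>p\<close> and column indices \<open>q\<close> and integrating out the phases
  leaves exactly the pairs with \<open>p\<close> in the solution set of the partition into fibres of \<open>q\<close>. Each
  partition \<open>\<rho>\<close> is the fibre partition of \<open>N (N - 1) \<cdots> (N - |\<rho>| + 1)\<close> maps \<open>q\<close>, which yields the limit of
  the moments. A solution is determined by its values off the minima of the blocks not containing 1,
  so \<open>K_\<rho> \<le> 1\<close> and the \<open>r\<close>-th limit moment is at most the \<open>r\<close>-th Bell number. Bell numbers have an
  entire exponential generating function, so the moments determine the characteristic function.
  Existence follows by compactness: averaging the phases over a fine grid instead of the torus does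
  not change the first \<open>N\<close> moments, and gives a finite average of spectral distributions of positive
  semidefinite matrices.
\<close>

section \<open>Solution sets and partitions\<close>

lemma finite_partitions: "finite (partitions r)"
  unfolding partitions_def by (rule finitely_many_partition_on) simp

text \<open>Descending through the positions, the equation of a block \<open>B\<close> determines
  the value at \<open>Min B\<close>: every other member of \<open>B\<close> lies above
  \<open>Min B\<close>, and so does every successor, except that \<open>r\<close> wraps around to 1.
  Keeping the value at 1 free makes this wrap harmless, and injectivity of \<open>k\<close> recovers
  \<open>p i\<close> from \<open>k (p i)\<close>.\<close>

lemma card_S_set_le:
  assumes inj: "inj_on k {1..N}" and r: "1 \<le> r" and \<rho>: "\<rho> \<in> partitions r"
  shows "card (S_set k r \<rho> N) \<le> N ^ (r + 1 - card \<rho>)"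
proof -
  have part: "partition_on {1..r} \<rho>" using \<rho> by (simp add: partitions_def)
  have fin: "finite \<rho>" using finite_elements[OF _ part] by simp
  have block: "finite B" "B \<noteq> {}" "B \<subseteq> {1..r}" if "B \<in> \<rho>" for B
  proof -
    show "B \<subseteq> {1..r}" using part that by (auto simp: partition_on_def)
    then show "finite B" by (rule finite_subset) simp
    show "B \<noteq> {}" using part that by (auto simp: partition_on_def)
  qed
  \<comment> \<open>All block equations add up to an identity, so at most |\<rho>| - 1 of them are
    independent; accordingly |\<rho>| - 1 positions are dropped. The position 1, which is the
    minimum of its block, is retained.\<close>
  define F where "F = {1..r} - (Min ` \<rho> - {1})"
  have inj_Min: "inj_on Min \<rho>"
  proof (rule inj_onI)
    fix B C assume "B \<in> \<rho>" "C \<in> \<rho>" "Min B = Min C"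
    then have "Min B \<in> B \<inter> C" using block Min_in by (metis IntI)
    then show "B = C" using part \<open>B \<in> \<rho>\<close> \<open>C \<in> \<rho>\<close> unfolding partition_on_def disjoint_def by blast
  qed
  have "1 \<in> \<Union>\<rho>" using part r by (auto simp: partition_on_def)
  then obtain B1 where B1: "B1 \<in> \<rho>" "1 \<in> B1" by blast
  have "Min B1 = 1" using block[OF B1(1)] B1(2) by (intro Min_eqI) auto
  then have one: "1 \<in> Min ` \<rho>" using B1(1) by force
  have sub: "Min ` \<rho> - {1} \<subseteq> {1..r}" using block Min_in by blast
  have "card F = r - (card \<rho> - 1)"
    unfolding F_def using sub one fin by (simp add: card_Diff_subset card_image[OF inj_Min])
  moreover have "card \<rho> \<ge> 1" using B1(1) fin by (metis One_nat_def Suc_leI card_gt_0_iff empty_iff)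
  ultimately have cardF: "card F = r + 1 - card \<rho>" by simp
  have "inj_on (\<lambda>p. restrict p F) (S_set k r \<rho> N)"
  proof (rule inj_onI)
    fix p p' assume p: "p \<in> S_set k r \<rho> N" and p': "p' \<in> S_set k r \<rho> N"
      and eq: "restrict p F = restrict p' F"
    have agree: "p i = p' i" if "i \<in> F" for i using eq that by (metis restrict_apply')
    have mem: "p i \<in> {1..N}" "p' i \<in> {1..N}" if "i \<in> {1..r}" for i
      using p p' that by (auto simp: S_set_def)
    have "p i = p' i" if "i \<in> {1..r}" for i
      using that
    \<comment> \<open>Descending induction on \<open>i\<close>, with \<open>r - i\<close> as the
      measure.\<close>
    proof (induction "r - i" arbitrary: i rule: less_induct)
      case less
      show ?case
      proof (cases "i \<in> F")
        case False
        then obtain B where B: "B \<in> \<rho>" "i = Min B" "i \<noteq> 1" using less.prems by (auto simp: F_def)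
        note b = block[OF B(1)]
        have iB: "i \<in> B" using Min_in[OF b(1,2)] B by simp
        have later: "p j = p' j" if "j \<in> {1..r}" "i < j" for j
          using less.hyps[of j] that by auto
        have le: "i \<le> s" if "s \<in> B" for s using B b that by simp
        have nxt: "p (cyc_next r s) = p' (cyc_next r s)" if "s \<in> B" for s
        proof (cases "s = r")
          case True
          have "1 \<in> F" using r by (simp add: F_def)
          then show ?thesis using True agree by (simp add: cyc_next_def)
        next
          case False
          then have "s + 1 \<in> {1..r}" using that b by fastforce
          then show ?thesis using le[OF that] False later by (simp add: cyc_next_def)
        qed
        have rest: "(\<Sum>s\<in>B - {i}. k (p s)) = (\<Sum>s\<in>B - {i}. k (p' s))"
        proof (intro sum.cong refl)
          fix s assume "s \<in> B - {i}"
          then have "i < s" "s \<in> {1..r}" using le[of s] b by auto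
          then show "k (p s) = k (p' s)" using later by simp
        qed
        \<comment> \<open>In the equation of \<open>B\<close> for \<open>p\<close> and for
          \<open>p'\<close>, the right-hand sides agree and so do all left-hand terms except the one
          at \<open>i\<close>; cancellation leaves \<open>k (p i) = k (p' i)\<close>.\<close>
        have "(\<Sum>s\<in>B. k (p s)) = (\<Sum>s\<in>B. k (p (cyc_next r s)))"
          using p B by (simp add: S_set_def)
        also have "\<dots> = (\<Sum>s\<in>B. k (p' (cyc_next r s)))" using nxt by simp
        also have "\<dots> = (\<Sum>s\<in>B. k (p' s))" using p' B by (simp add: S_set_def)
        finally have "k (p i) = k (p' i)"
          using rest sum.remove[OF b(1) iB, of "\<lambda>s. k (p s)"] sum.remove[OF b(1) iB, of "\<lambda>s. k (p' s)"]
          by linarith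
        then show ?thesis using inj mem[OF less.prems] by (auto dest: inj_onD)
      qed (rule agree)
    qed
    moreover have "p \<in> extensional {1..r}" "p' \<in> extensional {1..r}"
      using p p' by (auto simp: S_set_def PiE_def)
    ultimately show "p = p'" by (intro extensionalityI) auto
  qed
  moreover have "(\<lambda>p. restrict p F) ` S_set k r \<rho> N \<subseteq> F \<rightarrow>\<^sub>E {1..N}"
  proof (intro image_subsetI PiE_I)
    fix p i assume "p \<in> S_set k r \<rho> N" and i: "i \<in> F"
    then have "p \<in> {1..r} \<rightarrow>\<^sub>E {1..N}" by (simp add: S_set_def)
    then show "restrict p F i \<in> {1..N}" using i PiE_mem[of p "{1..r}" "\<lambda>_. {1..N}" i] by (simp add: F_def)
  qed simp
  moreover have "finite (F \<rightarrow>\<^sub>E {1..N})" by (intro finite_PiE) (auto simp: F_def)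
  ultimately have "card (S_set k r \<rho> N) \<le> card (F \<rightarrow>\<^sub>E {1..N})" by (rule card_inj_on_le)
  also have "\<dots> = N ^ (r + 1 - card \<rho>)" using cardF by (simp add: card_funcsetE F_def)
  finally show ?thesis .
qed

section \<open>Counting maps by their fibres\<close>

definition fibre_partition :: "nat \<Rightarrow> (nat \<Rightarrow> nat) \<Rightarrow> nat set set" where
  "fibre_partition r q = (\<lambda>j. {s \<in> {1..r}. q s = j}) ` (q ` {1..r})"

lemma fibre_partition_in_partitions: "fibre_partition r q \<in> partitions r"
  by (auto simp: fibre_partition_def partitions_def partition_on_def disjoint_def)

text \<open>A map with fibre partition \<open>\<rho>\<close> is the same as an injective labelling
  of the blocks of \<open>\<rho>\<close> by elements of \<open>{1..n}\<close>, so a falling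
  factorial counts them. Truncated subtraction makes the product vanish when
  \<open>n < card \<rho>\<close>.\<close>

lemma card_fibre_partition_eq:
  assumes \<rho>: "\<rho> \<in> partitions r"
  shows "card {q \<in> {1..r} \<rightarrow>\<^sub>E {1..n}. fibre_partition r q = \<rho>} = (\<Prod>i<card \<rho>. n - i)"
proof -
  have part: "partition_on {1..r} \<rho>" using \<rho> by (simp add: partitions_def)
  have fin: "finite \<rho>" using finite_elements[OF _ part] by simp
  have ex1: "\<exists>!B. B \<in> \<rho> \<and> s \<in> B" if "s \<in> {1..r}" for s
  proof -
    have "s \<in> \<Union>\<rho>" using that unfolding partition_onD1[OF part] .
    then obtain B where B: "B \<in> \<rho>" "s \<in> B" by blast
    show ?thesis
    proof (rule ex1I[of _ B])
      fix C assume C: "C \<in> \<rho> \<and> s \<in> C"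
      show "C = B"
        using disjointD[OF partition_onD2[OF part], of C B] B C by auto
    qed (use B in auto)
  qed
  define b where "b s = (THE B. B \<in> \<rho> \<and> s \<in> B)" for s
  have b: "b s \<in> \<rho>" "s \<in> b s" if "s \<in> {1..r}" for s
    using theI'[OF ex1[OF that]] by (auto simp: b_def)
  have b_eq: "b s = B" if "s \<in> B" "B \<in> \<rho>" for s B
  proof -
    have "s \<in> {1..r}" using partition_onD1[OF part] that by blast
    then show ?thesis using ex1[of s] b[of s] that by blast
  qed
  have block: "finite B" "B \<noteq> {}" "B \<subseteq> {1..r}" if "B \<in> \<rho>" for B
  proof -
    show "B \<subseteq> {1..r}" using part that by (auto simp: partition_on_def)
    then show "finite B" by (rule finite_subset) simp
    show "B \<noteq> {}" using part that by (auto simp: partition_on_def)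
  qed
  \<comment> \<open>\<open>\<Phi>\<close> turns a labelling \<open>g\<close> of the blocks into the
    map that is constant on each of them; the inverse reads the label off at the minimum of the
    block.\<close>
  define \<Phi> where "\<Phi> g = (\<lambda>s\<in>{1..r}. g (b s) :: nat)" for g
  have MinB: "Min B \<in> B" "Min B \<in> {1..r}" if "B \<in> \<rho>" for B
    using Min_in[OF block(1,2)[OF that]] block(3)[OF that] by auto
  have "bij_betw \<Phi> {g \<in> \<rho> \<rightarrow>\<^sub>E {1..n}. inj_on g \<rho>} {q \<in> {1..r} \<rightarrow>\<^sub>E {1..n}. fibre_partition r q = \<rho>}"
  proof (rule bij_betw_byWitness[where f' = "\<lambda>q. \<lambda>B\<in>\<rho>. q (Min B)"])
    show "\<forall>g\<in>{g \<in> \<rho> \<rightarrow>\<^sub>E {1..n}. inj_on g \<rho>}. (\<lambda>B\<in>\<rho>. \<Phi> g (Min B)) = g"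
    proof
      fix g assume g: "g \<in> {g \<in> \<rho> \<rightarrow>\<^sub>E {1..n}. inj_on g \<rho>}"
      have "(\<lambda>B\<in>\<rho>. \<Phi> g (Min B)) B = g B" for B
        using g MinB[of B] b_eq[of "Min B" B] by (cases "B \<in> \<rho>") (auto simp: \<Phi>_def dest: PiE_arb)
      then show "(\<lambda>B\<in>\<rho>. \<Phi> g (Min B)) = g" by blast
    qed
    \<comment> \<open>Two positions have the same value exactly if they share a block. This gives
      the inverse property below and later the injectivity of the labelling read off from
      \<open>q\<close>.\<close>
    have same: "q s = q t \<longleftrightarrow> b s = b t"
      if q: "fibre_partition r q = \<rho>" and st: "s \<in> {1..r}" "t \<in> {1..r}" for q s t
    proof -
      have "{u \<in> {1..r}. q u = q s} \<in> \<rho>" "{u \<in> {1..r}. q u = q t} \<in> \<rho>"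
        using st by (auto simp: q[symmetric] fibre_partition_def)
      then have "b s = {u \<in> {1..r}. q u = q s}" "b t = {u \<in> {1..r}. q u = q t}"
        using st by (auto intro!: b_eq)
      then show ?thesis using st by auto
    qed
    show "\<forall>q\<in>{q \<in> {1..r} \<rightarrow>\<^sub>E {1..n}. fibre_partition r q = \<rho>}. \<Phi> (\<lambda>B\<in>\<rho>. q (Min B)) = q"
    proof
      fix q assume q: "q \<in> {q \<in> {1..r} \<rightarrow>\<^sub>E {1..n}. fibre_partition r q = \<rho>}"
      have "\<Phi> (\<lambda>B\<in>\<rho>. q (Min B)) s = q s" for s
      proof (cases "s \<in> {1..r}")
        case True
        have "b (Min (b s)) = b s" using MinB b True by (intro b_eq) auto
        then have "q (Min (b s)) = q s" using same[of q "Min (b s)" s] q True MinB b by auto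
        then show ?thesis using True b by (simp add: \<Phi>_def)
      next
        case False
        then show ?thesis using q by (auto simp: \<Phi>_def dest: PiE_arb)
      qed
      then show "\<Phi> (\<lambda>B\<in>\<rho>. q (Min B)) = q" by blast
    qed
    show "\<Phi> ` {g \<in> \<rho> \<rightarrow>\<^sub>E {1..n}. inj_on g \<rho>} \<subseteq> {q \<in> {1..r} \<rightarrow>\<^sub>E {1..n}. fibre_partition r q = \<rho>}"
    proof clarify
      fix g assume g: "g \<in> \<rho> \<rightarrow>\<^sub>E {1..n}" "inj_on g \<rho>"
      have "{s \<in> {1..r}. \<Phi> g s = \<Phi> g t} = b t" if t: "t \<in> {1..r}" for t
      proof -
        have "{s \<in> {1..r}. \<Phi> g s = \<Phi> g t} = {s \<in> {1..r}. b s = b t}"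
        proof (intro Collect_cong conj_cong refl)
          fix s assume s: "s \<in> {1..r}"
          show "\<Phi> g s = \<Phi> g t \<longleftrightarrow> b s = b t"
            using s t b(1)[OF s] b(1)[OF t] inj_on_eq_iff[OF g(2)] by (simp add: \<Phi>_def)
        qed
        also have "\<dots> = b t" 
        proof (intro equalityI subsetI)
          fix s assume "s \<in> {s \<in> {1..r}. b s = b t}"
          then show "s \<in> b t" using b(2)[of s] by simp
        next
          fix s assume s: "s \<in> b t"
          then have "s \<in> {1..r}" using block(3)[OF b(1)[OF t]] by blast
          then show "s \<in> {s \<in> {1..r}. b s = b t}" using b_eq[OF s b(1)[OF t]] by simp
        qed
        finally show ?thesis .
      qed
      then have "fibre_partition r (\<Phi> g) = b ` {1..r}"
        by (auto simp: fibre_partition_def image_image)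
      also have "\<dots> = \<rho>"
      proof (intro equalityI subsetI)
        fix B assume B: "B \<in> \<rho>"
        then have "B = b (Min B)" using b_eq[of "Min B" B] MinB(1)[of B] by simp
        then show "B \<in> b ` {1..r}" using MinB(2)[OF B] by blast
      qed (use b in auto)
      finally show "\<Phi> g \<in> {1..r} \<rightarrow>\<^sub>E {1..n} \<and> fibre_partition r (\<Phi> g) = \<rho>"
        using g b by (auto simp: \<Phi>_def)
    qed
    show "(\<lambda>q. \<lambda>B\<in>\<rho>. q (Min B)) ` {q \<in> {1..r} \<rightarrow>\<^sub>E {1..n}. fibre_partition r q = \<rho>}
        \<subseteq> {g \<in> \<rho> \<rightarrow>\<^sub>E {1..n}. inj_on g \<rho>}"
    proof clarify
      fix q assume q: "q \<in> {1..r} \<rightarrow>\<^sub>E {1..n}" "\<rho> = fibre_partition r q"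
      have "inj_on (\<lambda>B\<in>\<rho>. q (Min B)) \<rho>"
      proof (rule inj_onI)
        fix B C assume BC: "B \<in> \<rho>" "C \<in> \<rho>" "(\<lambda>B\<in>\<rho>. q (Min B)) B = (\<lambda>B\<in>\<rho>. q (Min B)) C"
        then have "b (Min B) = b (Min C)" using same[of q "Min B" "Min C"] q(2) MinB by auto
        then show "B = C" using BC b_eq[of "Min B" B] b_eq[of "Min C" C] MinB by auto
      qed
      then show "(\<lambda>B\<in>fibre_partition r q. q (Min B)) \<in> fibre_partition r q \<rightarrow>\<^sub>E {1..n} \<and>
          inj_on (\<lambda>B\<in>fibre_partition r q. q (Min B)) (fibre_partition r q)"
        using q MinB by auto
    qed
  qed
  then have "card {q \<in> {1..r} \<rightarrow>\<^sub>E {1..n}. fibre_partition r q = \<rho>} = card {g \<in> \<rho> \<rightarrow>\<^sub>E {1..n}. inj_on g \<rho>}"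
    by (simp add: bij_betw_same_card)
  then show ?thesis
    using card_inj_on_subset_funcset[OF fin, of "{1..n}" \<rho>] by (simp add: atLeast0LessThan)
qed

lemma card_le_if_in_partitions:
  assumes "\<rho> \<in> partitions r"
  shows "card \<rho> \<le> r"
proof -
  have part: "partition_on {1..r} \<rho>" using assms by (simp add: partitions_def)
  have fin: "finite \<rho>" using finite_elements[OF _ part] by simp
  have finB: "finite B" if "B \<in> \<rho>" for B
  proof (rule finite_subset)
    show "B \<subseteq> {1..r}" using partition_onD1[OF part] that by blast
  qed simp
  have "card \<rho> = (\<Sum>B\<in>\<rho>. 1)" by simp
  also have "\<dots> \<le> sum card \<rho>"
    using partition_onD3[OF part] finB by (intro sum_mono) (metis One_nat_def Suc_leI card_gt_0_iff)
  also have "\<dots> = card (\<Union>\<rho>)"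
    using partition_onD2[OF part] finB by (intro card_Union_disjoint[symmetric]) auto
  finally have "card \<rho> \<le> card (\<Union>\<rho>)" .
  then show ?thesis unfolding partition_onD1[OF part, symmetric] by simp
qed

section \<open>Growth of the number of partitions\<close>

lemma sum_powser_le_exp:
  fixes x :: real
  assumes "finite I" "0 \<le> x"
  shows "(\<Sum>n\<in>I. x ^ n / fact n) \<le> exp x"
proof -
  have "(\<Sum>n\<in>I. x ^ n /\<^sub>R fact n) \<le> (\<Sum>n. x ^ n /\<^sub>R fact n)"
    using assms by (intro sum_le_suminf summable_exp_generic) auto
  then show ?thesis by (simp add: exp_def divide_inverse mult.commute)
qed

text \<open>A truncated form of Dobinski's formula, obtained by counting the functions
  \<open>{1..r} \<rightarrow> {1..n}\<close> by their fibres.\<close>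

lemma card_partitions_le_Dobinski:
  "real (card (partitions r)) \<le> (\<Sum>n\<le>r. real n ^ r / fact n)"
proof -
  have count: "real n ^ r = (\<Sum>\<rho>\<in>partitions r. real (\<Prod>i<card \<rho>. n - i))" for n
  proof -
    let ?P = "{1..r} \<rightarrow>\<^sub>E {1..n}"
    have fin: "finite ?P" by (intro finite_PiE) auto
    have "n ^ r = card ?P" by (simp add: card_funcsetE)
    also have "\<dots> = (\<Sum>q\<in>?P. 1)" by (rule card_eq_sum)
    also have "\<dots> = (\<Sum>\<rho>\<in>partitions r. \<Sum>q | q \<in> ?P \<and> fibre_partition r q = \<rho>. 1)"
      using fin finite_partitions fibre_partition_in_partitions by (intro sum.group[symmetric]) auto
    also have "\<dots> = (\<Sum>\<rho>\<in>partitions r. \<Prod>i<card \<rho>. n - i)"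
    proof (rule sum.cong[OF refl])
      fix \<rho> assume \<rho>: "\<rho> \<in> partitions r"
      show "(\<Sum>q | q \<in> ?P \<and> fibre_partition r q = \<rho>. 1) = (\<Prod>i<card \<rho>. n - i)"
        unfolding card_fibre_partition_eq[OF \<rho>, symmetric] by (rule card_eq_sum[symmetric])
    qed
    finally show ?thesis by (metis of_nat_power of_nat_sum)
  qed
  \<comment> \<open>Each partition with \<open>b\<close> blocks is counted as b!/b!, where the
    numerator is the falling factorial of \<open>b\<close> of length \<open>b\<close>.\<close>
  have "real (card (partitions r)) = (\<Sum>\<rho>\<in>partitions r. real (\<Prod>i<card \<rho>. card \<rho> - i) / fact (card \<rho>))"
  proof -
    have "(\<Prod>i<b. b - i) = fact b" for b :: nat
      by (simp add: fact_prod_rev atLeast0LessThan)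
    then have "real (\<Prod>i<b. b - i) / fact b = 1" for b :: nat
      by (simp only: of_nat_fact divide_self fact_nonzero not_False_eq_True)
    then show ?thesis by (simp only: sum_constant mult_1_right)
  qed
  \<comment> \<open>The previous expression is the term \<open>n = card \<rho>\<close> of the inner
    sum; all terms are nonnegative, and \<open>card \<rho> \<le> r\<close> puts that index in
    range.\<close>
  also have "\<dots> \<le> (\<Sum>\<rho>\<in>partitions r. \<Sum>n\<le>r. real (\<Prod>i<card \<rho>. n - i) / fact n)"
  proof (rule sum_mono)
    fix \<rho> assume "\<rho> \<in> partitions r"
    then have "card \<rho> \<in> {..r}" using card_le_if_in_partitions by simp
    then show "real (\<Prod>i<card \<rho>. card \<rho> - i) / fact (card \<rho>) \<le> (\<Sum>n\<le>r. real (\<Prod>i<card \<rho>. n - i) / fact n)"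
      by (intro member_le_sum[of _ _ "\<lambda>n. real (\<Prod>i<card \<rho>. n - i) / fact n"]) (auto simp del: of_nat_prod)
  qed
  also have "\<dots> = (\<Sum>n\<le>r. real n ^ r / fact n)"
    by (subst sum.swap) (simp add: count sum_divide_distrib del: of_nat_prod)
  finally show ?thesis .
qed

text \<open>Bounds the terms of the exponential generating function of the Bell numbers for every
  \<open>t\<close>, so its radius of convergence is infinite. In the Dobinski sum, (n t)^r / r! is
  at most exp(n t), and summing exp(t)^n / n! over \<open>n\<close> gives another
  exponential.\<close>

lemma card_partitions_le:
  fixes t :: real
  assumes "0 < t"
  shows "real (card (partitions r)) * t ^ r / fact r \<le> exp (exp t)"
proof -
  have "real (card (partitions r)) * t ^ r / fact r \<le> (\<Sum>n\<le>r. real n ^ r / fact n) * t ^ r / fact r"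
    using card_partitions_le_Dobinski assms by (intro divide_right_mono mult_right_mono) auto
  also have "\<dots> = (\<Sum>n\<le>r. ((real n * t) ^ r / fact r) / fact n)"
    by (simp add: sum_distrib_left sum_divide_distrib power_mult_distrib mult_ac)
  also have "\<dots> \<le> (\<Sum>n\<le>r. exp t ^ n / fact n)"
  proof (intro sum_mono divide_right_mono)
    fix n
    have "(real n * t) ^ r / fact r \<le> exp (real n * t)"
      using sum_powser_le_exp[of "{r}" "real n * t"] assms by simp
    then show "(real n * t) ^ r / fact r \<le> exp t ^ n" by (simp add: exp_of_nat_mult)
  qed simp
  also have "\<dots> \<le> exp (exp t)" by (intro sum_powser_le_exp) auto
  finally show ?thesis .
qed

section \<open>Moments under orthogonality of characters\<close>

lemma sum_PiE_insert:
  assumes "a \<notin> I"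
  shows "sum g (PiE (insert a I) B) = (\<Sum>p\<in>PiE I B. \<Sum>y\<in>B a. g (p(a := y)))"
proof -
  have "sum g (PiE (insert a I) B) = (\<Sum>(p, y)\<in>PiE I B \<times> B a. g (p(a := y)))"
    using assms
    by (intro sum.reindex_bij_witness[of _ "\<lambda>(p, y). p(a := y)" "\<lambda>p. (p(a := undefined), p a)"])
       (auto simp: PiE_def extensional_def)
  then show ?thesis by (simp add: sum.cartesian_product)
qed

text \<open>A matrix power is a sum over paths; the induction appends one vertex at the end. The
  starting row is imposed by a condition inside the sum rather than by the index set, so that the
  trace can later be interchanged with the sum over \<open>p\<close>.\<close>

lemma mat_pow_expand:
  assumes "1 \<le> r" "i \<in> {1..N}"
  shows "mat_pow N A r i j = (\<Sum>p \<in> {1..r} \<rightarrow>\<^sub>E {1..N}.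
    (if p 1 = i then (\<Prod>s\<in>{1..<r}. A (p s) (p (Suc s))) * A (p r) j else 0))"
  using assms(1)
proof (induction r arbitrary: j rule: nat_induct_at_least)
  case base
  have single: "sum g ({1..1::nat} \<rightarrow>\<^sub>E {1..N}) = (\<Sum>y\<in>{1..N}. g ((\<lambda>_. undefined)(1 := y)))"
    for g :: "(nat \<Rightarrow> nat) \<Rightarrow> complex"
    using sum_PiE_insert[of 1 "{}" g "\<lambda>_. {1..N}"] by (simp add: fun_upd_def)
  have "(\<Sum>p \<in> {1..1} \<rightarrow>\<^sub>E {1..N}.
      (if p 1 = i then (\<Prod>s\<in>{1..<1}. A (p s) (p (Suc s))) * A (p 1) j else 0))
    = (\<Sum>y\<in>{1..N}. if y = i then A y j else 0)"
    unfolding single by (intro sum.cong refl) simp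
  also have "\<dots> = mat_pow N A 1 i j"
    unfolding One_nat_def mat_pow.simps mat_mult_def mat_id_def
    by (intro sum.cong) auto
  finally show ?case by simp
next
  case (Suc r)
  have set: "{1..Suc r} = insert (Suc r) {1..r}" by auto
  have "(\<Sum>p \<in> {1..Suc r} \<rightarrow>\<^sub>E {1..N}.
      (if p 1 = i then (\<Prod>s\<in>{1..<Suc r}. A (p s) (p (Suc s))) * A (p (Suc r)) j else 0))
    = (\<Sum>p \<in> {1..r} \<rightarrow>\<^sub>E {1..N}. \<Sum>l\<in>{1..N}.
      (if p 1 = i then (\<Prod>s\<in>{1..<r}. A (p s) (p (Suc s))) * A (p r) l else 0) * A l j)"
    unfolding set
  proof (subst sum_PiE_insert, simp, intro sum.cong refl)
    fix p l assume "p \<in> {1..r} \<rightarrow>\<^sub>E {1..N}" "l \<in> {1..N}"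
    define q where "q = p(Suc r := l)"
    have q1: "q 1 = p 1" using Suc.hyps by (simp add: q_def)
    have "(\<Prod>s\<in>{1..<Suc r}. A (q s) (q (Suc s))) = (\<Prod>s\<in>{1..<r}. A (q s) (q (Suc s))) * A (q r) (q (Suc r))"
      using Suc.hyps by (simp add: prod.atLeastLessThan_Suc)
    also have "(\<Prod>s\<in>{1..<r}. A (q s) (q (Suc s))) = (\<Prod>s\<in>{1..<r}. A (p s) (p (Suc s)))"
      by (intro prod.cong) (auto simp: q_def)
    also have "A (q r) (q (Suc r)) = A (p r) l" by (simp add: q_def)
    finally have *: "(\<Prod>s\<in>{1..<Suc r}. A (q s) (q (Suc s))) = (\<Prod>s\<in>{1..<r}. A (p s) (p (Suc s))) * A (p r) l" .
    show "(if (p(Suc r := l)) 1 = i then (\<Prod>s\<in>{1..<Suc r}. A ((p(Suc r := l)) s) ((p(Suc r := l)) (Suc s))) *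
          A ((p(Suc r := l)) (Suc r)) j else 0)
       = (if p 1 = i then (\<Prod>s\<in>{1..<r}. A (p s) (p (Suc s))) * A (p r) l else 0) * A l j"
      unfolding q_def[symmetric] q1 * by (simp add: q_def)
  qed
  also have "\<dots> = (\<Sum>l\<in>{1..N}. mat_pow N A r i l * A l j)"
    unfolding Suc.IH by (subst sum.swap) (simp add: sum_distrib_right)
  finally show ?case by (simp add: mat_mult_def)
qed

text \<open>Summing over the diagonal closes each path: the condition \<open>p 1 = i\<close> selects
  a single \<open>i\<close>, and the last factor leads from \<open>p r\<close> back to
  \<open>p 1\<close>, which is what \<open>cyc_next\<close> encodes.\<close>

lemma ntrace_mat_pow:
  assumes "1 \<le> r"
  shows "ntrace N (mat_pow N A r) =
    (\<Sum>p \<in> {1..r} \<rightarrow>\<^sub>E {1..N}. \<Prod>s\<in>{1..r}. A (p s) (p (cyc_next r s))) / of_nat N"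
proof -
  let ?h = "\<lambda>p j. (\<Prod>s\<in>{1..<r}. A (p s) (p (Suc s))) * A (p r) j"
  have "(\<Sum>i = 1..N. mat_pow N A r i i) =
      (\<Sum>i = 1..N. \<Sum>p \<in> {1..r} \<rightarrow>\<^sub>E {1..N}. if p 1 = i then ?h p i else 0)"
    by (intro sum.cong refl mat_pow_expand assms)
  also have "\<dots> = (\<Sum>p \<in> {1..r} \<rightarrow>\<^sub>E {1..N}. \<Sum>i = 1..N. if p 1 = i then ?h p i else 0)"
    by (rule sum.swap)
  also have "\<dots> = (\<Sum>p \<in> {1..r} \<rightarrow>\<^sub>E {1..N}. \<Prod>s\<in>{1..r}. A (p s) (p (cyc_next r s)))"
  proof (intro sum.cong refl)
    fix p assume p: "p \<in> {1..r} \<rightarrow>\<^sub>E {1..N}"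
    then have p1: "p 1 \<in> {1..N}" by (rule PiE_mem) (use assms in auto)
    have "{1..r} = insert r {1..<r}" using assms by auto
    then have "(\<Prod>s\<in>{1..r}. A (p s) (p (cyc_next r s))) = (\<Prod>s\<in>{1..<r}. A (p s) (p (cyc_next r s))) * A (p r) (p (cyc_next r r))"
      by (simp add: mult.commute)
    also have "(\<Prod>s\<in>{1..<r}. A (p s) (p (cyc_next r s))) = (\<Prod>s\<in>{1..<r}. A (p s) (p (Suc s)))"
      by (intro prod.cong) (auto simp: cyc_next_def)
    also have "A (p r) (p (cyc_next r r)) = A (p r) (p 1)" by (simp add: cyc_next_def)
    finally show "(\<Sum>i = 1..N. if p 1 = i then ?h p i else 0) = (\<Prod>s\<in>{1..r}. A (p s) (p (cyc_next r s)))"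
      using p1 by (simp add: sum.delta)
  qed
  finally show ?thesis by (simp add: ntrace_def)
qed

lemma vandermonde_X_entry:
  "vandermonde_X k N \<theta> i j =
    (\<Sum>q = 1..N. cis (2 * pi * \<theta> q) ^ k i * cnj (cis (2 * pi * \<theta> q)) ^ k j) / of_nat N"
proof -
  have "complex_of_real (sqrt (real N)) * complex_of_real (sqrt (real N)) = of_nat N"
    by (simp flip: of_real_mult)
  then show ?thesis
    by (simp add: vandermonde_X_def mat_mult_def mat_adj_def vandermonde_def sum_divide_distrib)
qed

text \<open>The exponent of z_j in the monomial that is the product of z_(q s)^(e s) over all
  positions \<open>s\<close>.\<close>

definition multidegree :: "nat \<Rightarrow> (nat \<Rightarrow> nat) \<Rightarrow> (nat \<Rightarrow> nat) \<Rightarrow> nat \<Rightarrow> nat" where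
  "multidegree r q e j = (\<Sum>s | s \<in> {1..r} \<and> q s = j. e s)"

lemma prod_power_multidegree:
  fixes z :: "nat \<Rightarrow> 'a :: comm_monoid_mult"
  assumes "q \<in> {1..r} \<rightarrow> {1..N}"
  shows "(\<Prod>s\<in>{1..r}. z (q s) ^ e s) = (\<Prod>j\<in>{1..N}. z j ^ multidegree r q e j)"
proof -
  have "(\<Prod>s\<in>{1..r}. z (q s) ^ e s) = (\<Prod>j\<in>{1..N}. \<Prod>s | s \<in> {1..r} \<and> q s = j. z (q s) ^ e s)"
    using assms by (intro prod.group[symmetric]) auto
  also have "\<dots> = (\<Prod>j\<in>{1..N}. z j ^ multidegree r q e j)"
    by (intro prod.cong refl) (auto simp: multidegree_def power_sum)
  finally show ?thesis .
qed

text \<open>Each factor of the cyclic product chooses a column index \<open>q s\<close>; collecting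
  the powers of each phase turns the product into a monomial. The entries supply 1/N^r and the
  normalised trace one more 1/N. One constant coefficient and one index set of pairs give exactly
  the shape to which \<open>char_orthogonal\<close> applies.\<close>

lemma ntrace_vandermonde_X_pow:
  assumes "1 \<le> r"
  shows "ntrace N (mat_pow N (vandermonde_X k N \<theta>) r) =
    (\<Sum>(p, q) \<in> ({1..r} \<rightarrow>\<^sub>E {1..N}) \<times> ({1..r} \<rightarrow>\<^sub>E {1..N}). 1 / of_nat N ^ Suc r *
      (\<Prod>j\<in>{1..N}. cis (2 * pi * \<theta> j) ^ multidegree r q (k \<circ> p) j *
         cnj (cis (2 * pi * \<theta> j)) ^ multidegree r q (k \<circ> p \<circ> cyc_next r) j))"
proof -
  define z where "z j = cis (2 * pi * \<theta> j)" for j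
  have "(\<Prod>s\<in>{1..r}. vandermonde_X k N \<theta> (p s) (p (cyc_next r s)))
      = (\<Sum>q \<in> {1..r} \<rightarrow>\<^sub>E {1..N}. 1 / of_nat N ^ r * (\<Prod>j\<in>{1..N}. z j ^ multidegree r q (k \<circ> p) j *
         cnj (z j) ^ multidegree r q (k \<circ> p \<circ> cyc_next r) j))" for p
  proof -
    have "(\<Prod>s\<in>{1..r}. vandermonde_X k N \<theta> (p s) (p (cyc_next r s)))
      = 1 / of_nat N ^ r * (\<Prod>s\<in>{1..r}. \<Sum>y=1..N. z y ^ k (p s) * cnj (z y) ^ k (p (cyc_next r s)))"
      by (simp add: vandermonde_X_entry prod_dividef z_def)
    also have "(\<Prod>s\<in>{1..r}. \<Sum>y=1..N. z y ^ k (p s) * cnj (z y) ^ k (p (cyc_next r s)))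
      = (\<Sum>q \<in> {1..r} \<rightarrow>\<^sub>E {1..N}. \<Prod>s\<in>{1..r}. z (q s) ^ k (p s) * cnj (z (q s)) ^ k (p (cyc_next r s)))"
      by (rule prod_sum_PiE) auto
    also have "\<dots> = (\<Sum>q \<in> {1..r} \<rightarrow>\<^sub>E {1..N}. (\<Prod>j\<in>{1..N}. z j ^ multidegree r q (k \<circ> p) j *
         cnj (z j) ^ multidegree r q (k \<circ> p \<circ> cyc_next r) j))"
    proof (intro sum.cong refl)
      fix q assume q: "q \<in> {1..r} \<rightarrow>\<^sub>E {1..N}"
      then have q': "q \<in> {1..r} \<rightarrow> {1..N}" by auto
      show "(\<Prod>s\<in>{1..r}. z (q s) ^ k (p s) * cnj (z (q s)) ^ k (p (cyc_next r s))) =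
        (\<Prod>j\<in>{1..N}. z j ^ multidegree r q (k \<circ> p) j * cnj (z j) ^ multidegree r q (k \<circ> p \<circ> cyc_next r) j)"
        unfolding prod.distrib
        using prod_power_multidegree[OF q', of z "k \<circ> p"]
          prod_power_multidegree[OF q', of "\<lambda>j. cnj (z j)" "k \<circ> p \<circ> cyc_next r"]
        by simp
    qed
    finally show ?thesis by (simp add: sum_distrib_left)
  qed
  then show ?thesis
    unfolding ntrace_mat_pow[OF assms]
    by (simp add: sum.cartesian_product sum_divide_distrib case_prod_unfold z_def mult.commute)
qed

text \<open>Abstracts integration over the torus as well as averaging over a grid with at least \<open>D\<close> points
  per coordinate.\<close>

definition char_orthogonal :: "nat \<Rightarrow> nat \<Rightarrow> (((nat \<Rightarrow> real) \<Rightarrow> complex) \<Rightarrow> complex) \<Rightarrow> bool" where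
  "char_orthogonal N D E \<longleftrightarrow> (\<forall>(A :: ((nat \<Rightarrow> nat) \<times> (nat \<Rightarrow> nat)) set) c a b. finite A \<longrightarrow>
    (\<forall>x\<in>A. \<forall>j\<in>{1..N}. a x j < D \<and> b x j < D) \<longrightarrow>
    E (\<lambda>\<theta>. \<Sum>x\<in>A. c * (\<Prod>j\<in>{1..N}. cis (2 * pi * \<theta> j) ^ a x j * cnj (cis (2 * pi * \<theta> j)) ^ b x j))
      = (\<Sum>x\<in>A. c * (if \<forall>j\<in>{1..N}. a x j = b x j then 1 else 0)))"

text \<open>The exact moment for matrix size \<open>N \<ge> 1\<close>: the falling factorial counts
  the column maps with fibre partition \<open>\<rho>\<close>. At \<open>r = 0\<close> the general
  formula would give 1/N, whereas the normalised trace of the identity is 1.\<close>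

definition moment_sum :: "(nat \<Rightarrow> nat) \<Rightarrow> nat \<Rightarrow> nat \<Rightarrow> real" where
  "moment_sum k N r = (if r = 0 then 1 else
    (\<Sum>\<rho>\<in>partitions r. real (\<Prod>i<card \<rho>. N - i) * real (card (S_set k r \<rho> N))) / real N ^ Suc r)"

text \<open>The blocks are the nonempty fibres of \<open>q\<close>, and on the fibre over
  \<open>j\<close> the block equation is an equality of multidegrees at \<open>j\<close>. For
  \<open>j\<close> outside the image of \<open>q\<close> both multidegrees are 0.\<close>

lemma mem_S_set_fibre_partition:
  assumes q: "q \<in> {1..r} \<rightarrow>\<^sub>E {1..N}" and p: "p \<in> {1..r} \<rightarrow>\<^sub>E {1..N}"
  shows "p \<in> S_set k r (fibre_partition r q) N \<longleftrightarrow>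
    (\<forall>j\<in>{1..N}. multidegree r q (k \<circ> p) j = multidegree r q (k \<circ> p \<circ> cyc_next r) j)"
proof -
  have "q ` {1..r} \<subseteq> {1..N}" using q by auto
  moreover have "multidegree r q e j = 0" if "j \<notin> q ` {1..r}" for e j
  proof -
    have "{s. s \<in> {1..r} \<and> q s = j} = {}" using that by blast
    then show ?thesis by (simp only: multidegree_def sum.empty)
  qed
  ultimately have "(\<forall>j\<in>{1..N}. multidegree r q (k \<circ> p) j = multidegree r q (k \<circ> p \<circ> cyc_next r) j) \<longleftrightarrow>
     (\<forall>j\<in>q ` {1..r}. multidegree r q (k \<circ> p) j = multidegree r q (k \<circ> p \<circ> cyc_next r) j)"
    by (metis subsetD)
  then show ?thesis using p by (simp add: S_set_def fibre_partition_def multidegree_def)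
qed

text \<open>The term of \<open>(p, q)\<close> survives exactly if every phase occurs with the same
  exponent as its conjugate, that is, if \<open>p\<close> solves the equations of the fibre
  partition of \<open>q\<close>. The bound on \<open>r * k p\<close> keeps all exponents below
  \<open>D\<close>, as each multidegree adds at most \<open>r\<close> values of
  \<open>k\<close>.\<close>

lemma char_orthogonal_ntrace_pow:
  assumes E: "char_orthogonal N D E" and N: "1 \<le> N"
    and D: "\<And>p. p \<in> {1..N} \<Longrightarrow> r * k p < D"
  shows "E (\<lambda>\<theta>. ntrace N (mat_pow N (vandermonde_X k N \<theta>) r)) = of_real (moment_sum k N r)"
proof (cases "r = 0")
  case True
  \<comment> \<open>A one-term sum of trivial characters yields the value of \<open>E\<close> at the
    constant 1; \<open>0 < D\<close> comes from the degree bound at \<open>r = 0\<close>.\<close>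
  have "E (\<lambda>\<theta>. \<Sum>x\<in>{(\<lambda>_. 0, \<lambda>_. 0)}. 1 * (\<Prod>j\<in>{1..N}. cis (2 * pi * \<theta> j) ^ 0 * cnj (cis (2 * pi * \<theta> j)) ^ 0))
      = (\<Sum>x\<in>{(\<lambda>_. 0, \<lambda>_. 0)}. 1 * (if \<forall>j\<in>{1..N}. (0::nat) = 0 then 1 else 0))"
    using E[unfolded char_orthogonal_def, rule_format,
        of "{(\<lambda>_. 0, \<lambda>_. 0)}" "\<lambda>_ _. 0" "\<lambda>_ _. 0" 1] D N True by auto
  then show ?thesis using True N by (simp add: ntrace_def mat_id_def moment_sum_def)
next
  case False
  then have r: "1 \<le> r" by simp
  let ?P = "{1..r} \<rightarrow>\<^sub>E {1..N}"
  have finP: "finite ?P" by (intro finite_PiE) auto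
  have bound: "multidegree r q e j < D" if e: "\<And>s. s \<in> {1..r} \<Longrightarrow> e s \<in> k ` {1..N}" for q e j
  proof -
    have "Max (k ` {1..N}) \<in> k ` {1..N}" using N by (intro Max_in) auto
    then obtain p where p: "p \<in> {1..N}" "Max (k ` {1..N}) = k p" by auto
    have e_le: "e s \<le> k p" if "s \<in> {1..r}" for s
      using e[OF that] p(2) by (metis Max_ge finite_atLeastAtMost finite_imageI)
    have "multidegree r q e j \<le> (\<Sum>s | s \<in> {1..r} \<and> q s = j. k p)"
      unfolding multidegree_def using e_le by (intro sum_mono) simp
    also have "\<dots> \<le> (\<Sum>s\<in>{1..r}. k p)" by (intro sum_mono2) auto
    finally show ?thesis using D[OF p(1)] by simp
  qed
  have "E (\<lambda>\<theta>. ntrace N (mat_pow N (vandermonde_X k N \<theta>) r)) =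
    (\<Sum>x\<in>?P \<times> ?P. 1 / of_nat N ^ Suc r *
      (if \<forall>j\<in>{1..N}. multidegree r (snd x) (k \<circ> fst x) j = multidegree r (snd x) (k \<circ> fst x \<circ> cyc_next r) j then 1 else 0))"
    unfolding ntrace_vandermonde_X_pow[OF r] case_prod_unfold
  proof (rule E[unfolded char_orthogonal_def, rule_format])
    show "finite (?P \<times> ?P)" using finP by simp
    fix x j assume x: "x \<in> ?P \<times> ?P" "j \<in> {1..N}"
    then have "fst x \<in> ?P" by auto
    then have val: "fst x s \<in> {1..N}" if "s \<in> {1..r}" for s using that by (rule PiE_mem)
    have "cyc_next r s \<in> {1..r}" if "s \<in> {1..r}" for s using that r by (auto simp: cyc_next_def)
    then show "multidegree r (snd x) (k \<circ> fst x) j < D \<and> multidegree r (snd x) (k \<circ> fst x \<circ> cyc_next r) j < D"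
      by (intro conjI bound) (simp_all only: comp_apply imageI val)
  qed
  also have "\<dots> = (\<Sum>x\<in>?P \<times> ?P. if fst x \<in> S_set k r (fibre_partition r (snd x)) N then 1 else 0) / of_nat N ^ Suc r"
    unfolding sum_divide_distrib
    by (intro sum.cong refl) (auto simp: mem_S_set_fibre_partition mem_Times_iff)
  also have "(\<Sum>x\<in>?P \<times> ?P. if fst x \<in> S_set k r (fibre_partition r (snd x)) N then 1 else 0)
     = (\<Sum>q\<in>?P. \<Sum>p\<in>?P. if p \<in> S_set k r (fibre_partition r q) N then 1 else (0 :: complex))"
    unfolding case_prod_unfold[symmetric] by (subst sum.swap) (simp add: sum.cartesian_product case_prod_unfold)
  also have "\<dots> = (\<Sum>q\<in>?P. of_nat (card (S_set k r (fibre_partition r q) N)))"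
  proof (intro sum.cong refl)
    fix q
    have "?P \<inter> S_set k r (fibre_partition r q) N = S_set k r (fibre_partition r q) N"
      by (auto simp: S_set_def)
    then show "(\<Sum>p\<in>?P. if p \<in> S_set k r (fibre_partition r q) N then 1 else 0) =
        of_nat (card (S_set k r (fibre_partition r q) N))"
      using finP by (simp add: sum.If_cases)
  qed
  \<comment> \<open>The summand depends on \<open>q\<close> only through its fibre partition, so the
    maps \<open>q\<close> are grouped by it and counted.\<close>
  also have "\<dots> = (\<Sum>\<rho>\<in>partitions r. \<Sum>q | q \<in> ?P \<and> fibre_partition r q = \<rho>. of_nat (card (S_set k r (fibre_partition r q) N)))"
    using finP finite_partitions fibre_partition_in_partitions by (intro sum.group[symmetric]) auto
  also have "\<dots> = (\<Sum>\<rho>\<in>partitions r. of_nat (\<Prod>i<card \<rho>. N - i) * of_nat (card (S_set k r \<rho> N)))"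
  proof (intro sum.cong refl)
    fix \<rho> assume \<rho>: "\<rho> \<in> partitions r"
    have "(\<Sum>q | q \<in> ?P \<and> fibre_partition r q = \<rho>. of_nat (card (S_set k r (fibre_partition r q) N)))
        = (\<Sum>q | q \<in> ?P \<and> fibre_partition r q = \<rho>. of_nat (card (S_set k r \<rho> N)) :: complex)"
      by (intro sum.cong) auto
    then show "(\<Sum>q | q \<in> ?P \<and> fibre_partition r q = \<rho>. of_nat (card (S_set k r (fibre_partition r q) N)))
        = (of_nat (\<Prod>i<card \<rho>. N - i) * of_nat (card (S_set k r \<rho> N)) :: complex)"
      by (simp only: sum_constant card_fibre_partition_eq[OF \<rho>])
  qed
  finally show ?thesis using False by (simp add: moment_sum_def)
qed

section \<open>Orthogonality of characters on the torus and on the grid\<close>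

lemma cis_power_mult_cnj_power: "cis x ^ a * cnj (cis x) ^ b = cis ((real a - real b) * x)"
  by (simp add: cis_cnj Complex.DeMoivre cis_mult algebra_simps)

text \<open>For \<open>a \<noteq> b\<close> the character has the antiderivative cis(d x) / (i d),
  where d is a nonzero integer multiple of 2 pi, so its values at 0 and 1 coincide. The uniform
  measure enters as a density with respect to Lebesgue measure.\<close>

lemma has_bochner_integral_cis:
  fixes a b :: nat
  shows "has_bochner_integral (uniform_measure lborel {0..1})
    (\<lambda>x. cis (2 * pi * x) ^ a * cnj (cis (2 * pi * x)) ^ b) (if a = b then 1 else 0)"
proof -
  let ?d = "2 * pi * (real a - real b)"
  have "has_bochner_integral lborel (\<lambda>x. indicator {0..1} x *\<^sub>R cis (?d * x)) (if a = b then 1 else 0)"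
  proof (cases "a = b")
    case True
    have "(complex_of_real has_vector_derivative 1) (at x within {0..1})" for x
      unfolding has_vector_derivative_def of_real_def
      by (intro bounded_linear_imp_has_derivative bounded_linear_scaleR_left)
    then show ?thesis
      using has_bochner_integral_FTC_Icc[of 0 1 complex_of_real "\<lambda>_. 1"] True by simp
  next
    case False
    let ?F = "\<lambda>x. cis (?d * x) / (\<i> * of_real ?d)"
    have "has_bochner_integral lborel (\<lambda>x. indicator {0..1} x *\<^sub>R cis (?d * x)) (?F 1 - ?F 0)"
    proof (rule has_bochner_integral_FTC_Icc)
      fix x :: real
      have d: "\<i> * complex_of_real ?d \<noteq> 0" using False by simp
      have "((\<lambda>z. exp (\<i> * of_real ?d * z) / (\<i> * of_real ?d)) has_field_derivative
          exp (\<i> * of_real ?d * of_real x)) (at (of_real x))"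
        using d by (auto intro!: derivative_eq_intros simp del: of_real_mult of_real_diff)
      from has_vector_derivative_real_field[OF this]
      show "(?F has_vector_derivative cis (?d * x)) (at x within {0..1})"
        by (simp add: cis_conv_exp mult.assoc)
    qed (auto intro!: continuous_intros)
    moreover have "cis ?d = 1"
      using cis_multiple_2pi[of "real a - real b"] by (simp add: mult_ac)
    ultimately show ?thesis using False by simp
  qed
  moreover have "(\<lambda>x. cis (?d * x)) \<in> borel_measurable lborel"
  proof -
    have "continuous_on UNIV (\<lambda>x. cis (?d * x))"
      unfolding cis_conv_exp by (intro continuous_intros)
    from borel_measurable_continuous_onI[OF this] show ?thesis by simp
  qed
  ultimately have "has_bochner_integral (density lborel (\<lambda>x. ennreal (indicator {0..1} x)))
      (\<lambda>x. cis (?d * x)) (if a = b then 1 else 0)"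
    by (intro has_bochner_integral_density) auto
  moreover have "uniform_measure lborel {0..1 :: real} = density lborel (\<lambda>x. ennreal (indicator {0..1} x))"
    by (simp add: uniform_measure_def ennreal_indicator divide_ennreal_def)
  ultimately show ?thesis by (simp add: cis_power_mult_cnj_power mult_ac)
qed

text \<open>Independence of the coordinates: the integral of a product of characters is the product
  of the one-dimensional integrals, each of which is 0 or 1.\<close>

lemma char_orthogonal_theta_law: "char_orthogonal N D (\<lambda>f. LINT \<theta>|theta_law N. f \<theta>)"
  unfolding char_orthogonal_def
proof (intro allI impI)
  fix A :: "((nat \<Rightarrow> nat) \<times> (nat \<Rightarrow> nat)) set" and c :: complex and a b :: "(nat \<Rightarrow> nat) \<times> (nat \<Rightarrow> nat) \<Rightarrow> nat \<Rightarrow> nat"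
  assume "finite A"
  let ?f = "\<lambda>x j \<theta>. cis (2 * pi * \<theta>) ^ a x j * cnj (cis (2 * pi * \<theta>)) ^ b x j"
  let ?U = "uniform_measure lborel {0..1} :: real measure"
  interpret U: prob_space ?U by (intro prob_space_uniform_measure) auto
  interpret product_sigma_finite "\<lambda>_ :: nat. ?U" by standard
  note bi = has_bochner_integral_cis
  have int: "integrable (theta_law N) (\<lambda>\<theta>. \<Prod>j\<in>{1..N}. ?f x j (\<theta> j))" for x
    unfolding theta_law_def by (intro product_integrable_prod integrable.intros[OF bi]) simp
  have "(LINT \<theta>|theta_law N. (\<Prod>j\<in>{1..N}. ?f x j (\<theta> j))) = (if \<forall>j\<in>{1..N}. a x j = b x j then 1 else 0)" for x
  proof -
    have "(LINT \<theta>|theta_law N. (\<Prod>j\<in>{1..N}. ?f x j (\<theta> j))) = (\<Prod>j\<in>{1..N}. (LINT y|?U. ?f x j y))"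
      unfolding theta_law_def by (intro product_integral_prod integrable.intros[OF bi]) simp
    also have "\<dots> = (\<Prod>j\<in>{1..N}. if a x j = b x j then 1 else 0)"
      by (intro prod.cong refl has_bochner_integral_integral_eq[OF bi])
    also have "\<dots> = (if \<forall>j\<in>{1..N}. a x j = b x j then 1 else 0)"
      by (auto intro!: prod.neutral)
    finally show ?thesis .
  qed
  then show "(LINT \<theta>|theta_law N. (\<Sum>x\<in>A. c * (\<Prod>j\<in>{1..N}. ?f x j (\<theta> j))))
      = (\<Sum>x\<in>A. c * (if \<forall>j\<in>{1..N}. a x j = b x j then 1 else 0))"
    using int by simp
qed

definition grid_point :: "nat \<Rightarrow> (nat \<Rightarrow> nat) \<Rightarrow> nat \<Rightarrow> real" where
  "grid_point M g j = real (g j) / real M"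

text \<open>A geometric sum whose ratio \<open>w\<close> is an M-th root of unity. As
  \<open>a\<close> and \<open>b\<close> are below \<open>M\<close>, the ratio is 1 only for
  \<open>a = b\<close>: otherwise \<open>M\<close> would divide a nonzero integer of absolute value
  less than \<open>M\<close>.\<close>

lemma sum_roots_of_unity:
  assumes "a < M" "b < M"
  shows "(\<Sum>y<M. cis (2 * pi * (real y / real M)) ^ a * cnj (cis (2 * pi * (real y / real M))) ^ b)
    = (if a = b then of_nat M else 0)"
proof -
  define w where "w = cis (2 * pi * ((real a - real b) / real M))"
  have "(\<Sum>y<M. cis (2 * pi * (real y / real M)) ^ a * cnj (cis (2 * pi * (real y / real M))) ^ b) = (\<Sum>y<M. w ^ y)"
  proof (rule sum.cong[OF refl])
    fix y
    have "w ^ y = cis ((real a - real b) * (2 * pi * (real y / real M)))"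
      unfolding w_def Complex.DeMoivre by (rule arg_cong[of _ _ cis]) (simp add: field_simps)
    then show "cis (2 * pi * (real y / real M)) ^ a * cnj (cis (2 * pi * (real y / real M))) ^ b = w ^ y"
      by (simp only: cis_power_mult_cnj_power)
  qed
  also have "\<dots> = (if a = b then of_nat M else 0)"
  proof (cases "a = b")
    case False
    have "w \<noteq> 1"
    proof
      assume "w = 1"
      then have "cos (2 * pi * ((real a - real b) / real M)) = 1" by (simp add: w_def complex_eq_iff)
      then obtain i :: int where "2 * pi * ((real a - real b) / real M) = of_int i * 2 * pi"
        by (auto simp: cos_one_2pi_int)
      then have "(real a - real b) / real M = of_int i" by (simp flip: times_divide_eq_right)
      then have "real a - real b = of_int (i * int M)" using assms by (simp add: field_simps)
      then have "int a - int b = i * int M" by linarith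
      then have "int M dvd int a - int b" by simp
      then have "int M \<le> \<bar>int a - int b\<bar>" using False by (intro zdvd_imp_le) auto
      then show False using assms by linarith
    qed
    moreover have "w ^ M = 1"
    proof -
      have "w ^ M = cis (2 * pi * (real a - real b))" using assms by (simp add: w_def Complex.DeMoivre)
      then show ?thesis using cis_multiple_2pi[of "real a - real b"] by (simp add: mult_ac)
    qed
    ultimately show ?thesis using False by (simp add: geometric_sum)
  qed (simp add: w_def)
  finally show ?thesis .
qed

text \<open>The grid sum factors over the coordinates into sums of roots of unity. For exponents
  below \<open>M\<close> the average agrees with the one over the torus, yet it involves only
  finitely many phase vectors.\<close>

lemma char_orthogonal_grid:
  assumes "0 < M"
  shows "char_orthogonal N M (\<lambda>f. (\<Sum>g \<in> {1..N} \<rightarrow>\<^sub>E {..<M}. f (grid_point M g)) / of_nat M ^ N)"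
  unfolding char_orthogonal_def
proof (intro allI impI)
  fix A :: "((nat \<Rightarrow> nat) \<times> (nat \<Rightarrow> nat)) set" and c :: complex and a b :: "(nat \<Rightarrow> nat) \<times> (nat \<Rightarrow> nat) \<Rightarrow> nat \<Rightarrow> nat"
  assume bound: "\<forall>x\<in>A. \<forall>j\<in>{1..N}. a x j < M \<and> b x j < M"
  let ?f = "\<lambda>x j \<theta>. cis (2 * pi * \<theta>) ^ a x j * cnj (cis (2 * pi * \<theta>)) ^ b x j"
  have "(\<Sum>g \<in> {1..N} \<rightarrow>\<^sub>E {..<M}. \<Prod>j\<in>{1..N}. ?f x j (grid_point M g j))
      = of_nat M ^ N * (if \<forall>j\<in>{1..N}. a x j = b x j then 1 else 0)" if x: "x \<in> A" for x
  proof -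
    have "(\<Sum>g \<in> {1..N} \<rightarrow>\<^sub>E {..<M}. \<Prod>j\<in>{1..N}. ?f x j (grid_point M g j))
        = (\<Prod>j\<in>{1..N}. \<Sum>y<M. ?f x j (real y / real M))"
      unfolding grid_point_def by (subst prod_sum_PiE) auto
    also have "\<dots> = (\<Prod>j\<in>{1..N}. if a x j = b x j then of_nat M else 0)"
      using bound x by (intro prod.cong refl sum_roots_of_unity) auto
    also have "\<dots> = of_nat M ^ N * (if \<forall>j\<in>{1..N}. a x j = b x j then 1 else 0)"
    proof (cases "\<forall>j\<in>{1..N}. a x j = b x j")
      case True
      then have "(\<Prod>j\<in>{1..N}. if a x j = b x j then of_nat M else 0) = (\<Prod>j\<in>{1..N}. (of_nat M :: complex))"
        by (intro prod.cong) auto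
      then show ?thesis using True by simp
    qed auto
    finally show ?thesis .
  qed
  note grid = this
  have "(\<Sum>g \<in> {1..N} \<rightarrow>\<^sub>E {..<M}. \<Sum>x\<in>A. c * (\<Prod>j\<in>{1..N}. ?f x j (grid_point M g j)))
     = (\<Sum>x\<in>A. c * (\<Sum>g \<in> {1..N} \<rightarrow>\<^sub>E {..<M}. \<Prod>j\<in>{1..N}. ?f x j (grid_point M g j)))"
    by (subst sum.swap) (simp add: sum_distrib_left)
  also have "\<dots>
     = (\<Sum>x\<in>A. c * (of_nat M ^ N * (if \<forall>j\<in>{1..N}. a x j = b x j then 1 else 0)))"
    by (rule sum.cong[OF refl]) (simp only: grid)
  finally have eq: "(\<Sum>g \<in> {1..N} \<rightarrow>\<^sub>E {..<M}. \<Sum>x\<in>A. c * (\<Prod>j\<in>{1..N}. ?f x j (grid_point M g j)))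
     = (\<Sum>x\<in>A. c * (of_nat M ^ N * (if \<forall>j\<in>{1..N}. a x j = b x j then 1 else 0)))"
    .
  show "(\<Sum>g \<in> {1..N} \<rightarrow>\<^sub>E {..<M}. \<Sum>x\<in>A. c * (\<Prod>j\<in>{1..N}. ?f x j (grid_point M g j))) / of_nat M ^ N
      = (\<Sum>x\<in>A. c * (if \<forall>j\<in>{1..N}. a x j = b x j then 1 else 0))"
    unfolding eq sum_divide_distrib by (intro sum.cong refl) (use assms in simp)
qed

section \<open>Eigenvalues\<close>

text \<open>Transfers powers to the library matrices, whose indices start at 0 instead of 1.\<close>

lemma mat_pow_eq_pow_mat:
  assumes "i < n" "j < n"
  shows "(Matrix.mat n n (\<lambda>(i, j). A (Suc i) (Suc j)) ^\<^sub>m r) $$ (i, j) = mat_pow n A r (Suc i) (Suc j)"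
  using assms
proof (induction r arbitrary: j)
  case 0
  then show ?case by (simp add: mat_id_def)
next
  case (Suc r)
  let ?M = "Matrix.mat n n (\<lambda>(i, j). A (Suc i) (Suc j))"
  have pow: "?M ^\<^sub>m r \<in> carrier_mat n n" by (rule pow_carrier_mat) simp
  have "(?M ^\<^sub>m Suc r) $$ (i, j) = (\<Sum>l\<in>{0..<n}. (?M ^\<^sub>m r) $$ (i, l) * ?M $$ (l, j))"
    using pow Suc.prems by (auto simp: scalar_prod_def intro!: sum.cong)
  also have "\<dots> = (\<Sum>l<n. mat_pow n A r (Suc i) (Suc l) * A (Suc l) (Suc j))"
    using Suc by (simp add: atLeast0LessThan)
  also have "\<dots> = mat_pow n A (Suc r) (Suc i) (Suc j)"
    by (simp add: mat_mult_def sum.atLeast1_atMost_eq)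
  finally show ?case .
qed

lemma sum_diag_mult_commute:
  fixes A B :: "'a :: comm_semiring_0 mat"
  assumes "A \<in> carrier_mat n n" "B \<in> carrier_mat n n"
  shows "(\<Sum>i<n. (A * B) $$ (i, i)) = (\<Sum>i<n. (B * A) $$ (i, i))"
proof -
  have "(\<Sum>i<n. (C * E) $$ (i, i)) = (\<Sum>i<n. \<Sum>j<n. C $$ (i, j) * E $$ (j, i))"
    if "C \<in> carrier_mat n n" "E \<in> carrier_mat n n" for C E :: "'a mat"
    using that by (auto simp: scalar_prod_def atLeast0LessThan intro!: sum.cong)
  note this[OF assms] this[OF assms(2,1)]
  moreover have "(\<Sum>i<n. \<Sum>j<n. A $$ (i, j) * B $$ (j, i)) = (\<Sum>i<n. \<Sum>j<n. B $$ (i, j) * A $$ (j, i))"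
    by (subst sum.swap) (simp add: mult.commute)
  ultimately show ?thesis by simp
qed

text \<open>In the sum over \<open>l\<close> for the entry at \<open>(i, j)\<close> of the next
  power, only \<open>i \<le> l \<le> j\<close> can contribute: no index below the diagonal, and only
  \<open>l = i\<close> on it.\<close>

lemma upper_triangular_pow:
  fixes T :: "'a :: comm_semiring_1 mat"
  assumes T: "T \<in> carrier_mat n n" "upper_triangular T"
  shows "upper_triangular (T ^\<^sub>m r) \<and> (\<forall>i<n. (T ^\<^sub>m r) $$ (i, i) = T $$ (i, i) ^ r)"
proof (induction r)
  case 0
  then show ?case using T by auto
next
  case (Suc r)
  have pow: "T ^\<^sub>m r \<in> carrier_mat n n" using T(1) by (rule pow_carrier_mat)
  have entry: "(T ^\<^sub>m Suc r) $$ (i, j) = (\<Sum>l<n. (T ^\<^sub>m r) $$ (i, l) * T $$ (l, j))"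
    if "i < n" "j < n" for i j
    using that T(1) pow by (auto simp: scalar_prod_def atLeast0LessThan intro!: sum.cong)
  have Tz: "T $$ (l, j) = 0" if "j < l" "l < n" for l j
    using that T by auto
  have Pz: "(T ^\<^sub>m r) $$ (i, l) = 0" if "l < i" "i < n" for l i
    using that Suc.IH pow by auto
  have zero: "(T ^\<^sub>m r) $$ (i, l) * T $$ (l, j) = 0" if "i < n" "l < n" "l < i \<or> j < l" for i j l
    using that Tz Pz by auto
  show ?case
  proof (intro conjI allI impI upper_triangularI)
    fix i j assume ij: "j < i" "i < dim_row (T ^\<^sub>m Suc r)"
    then have "i < n" using T(1) pow by simp
    then show "(T ^\<^sub>m Suc r) $$ (i, j) = 0"
      using ij by (subst entry) (auto intro!: sum.neutral zero)
  next
    fix i assume i: "i < n"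
    have "(T ^\<^sub>m Suc r) $$ (i, i) = (\<Sum>l\<in>{i}. (T ^\<^sub>m r) $$ (i, l) * T $$ (l, i))"
      using i unfolding entry[OF i i] by (intro sum.mono_neutral_right) (auto intro!: zero)
    then show "(T ^\<^sub>m Suc r) $$ (i, i) = T $$ (i, i) ^ Suc r"
      using Suc.IH i by (simp add: mult.commute)
  qed
qed

text \<open>If v is an eigenvector of V V* for \<open>e\<close>, then |V* v|^2 = <V V* v, v> = e
  |v|^2, so \<open>e\<close> is a quotient of squared norms.\<close>

lemma eigenvalue_mult_adjoint_nonneg:
  fixes V :: "nat \<Rightarrow> nat \<Rightarrow> complex"
  assumes ev: "eigenvalue (Matrix.mat n n (\<lambda>(i, j). mat_mult n V (mat_adj V) (Suc i) (Suc j))) e"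
  shows "\<exists>x\<ge>0. e = complex_of_real x"
proof -
  let ?M = "Matrix.mat n n (\<lambda>(i, j). mat_mult n V (mat_adj V) (Suc i) (Suc j))"
  obtain v where v: "v \<in> carrier_vec n" "v \<noteq> 0\<^sub>v n" "?M *\<^sub>v v = e \<cdot>\<^sub>v v"
    using ev by (auto simp: eigenvalue_def eigenvector_def)
  \<comment> \<open>\<open>u\<close> is V* v, \<open>R\<close> its squared norm, and
    \<open>S\<close> the squared norm of \<open>v\<close>.\<close>
  define u where "u l = (\<Sum>j<n. cnj (V (Suc j) l) * v $ j)" for l
  define R where "R = (\<Sum>l=1..n. (cmod (u l))\<^sup>2)"
  define S where "S = (\<Sum>i<n. (cmod (v $ i))\<^sup>2)"
  have entry: "(\<Sum>j<n. mat_mult n V (mat_adj V) (Suc i) (Suc j) * v $ j) = e * v $ i" if "i < n" for i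
  proof -
    have "(?M *\<^sub>v v) $ i = e * v $ i" using v that by simp
    then show ?thesis using that v(1) by (simp add: scalar_prod_def atLeast0LessThan)
  qed
  have "complex_of_real R = (\<Sum>l=1..n. (\<Sum>i<n. V (Suc i) l * cnj (v $ i)) * u l)"
    unfolding R_def of_real_sum
    by (intro sum.cong refl) (simp add: u_def complex_norm_square mult.commute del: of_real_power)
  also have "\<dots> = (\<Sum>l=1..n. \<Sum>i<n. cnj (v $ i) * (\<Sum>j<n. V (Suc i) l * cnj (V (Suc j) l) * v $ j))"
    unfolding u_def by (simp add: sum_distrib_left sum_distrib_right mult_ac)
  also have "\<dots> = (\<Sum>i<n. cnj (v $ i) * (\<Sum>l=1..n. \<Sum>j<n. V (Suc i) l * cnj (V (Suc j) l) * v $ j))"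
    by (subst sum.swap) (simp add: sum_distrib_left)
  also have "\<dots> = (\<Sum>i<n. cnj (v $ i) * (\<Sum>j<n. mat_mult n V (mat_adj V) (Suc i) (Suc j) * v $ j))"
  proof (rule sum.cong[OF refl])
    fix i
    have "(\<Sum>l=1..n. \<Sum>j<n. V (Suc i) l * cnj (V (Suc j) l) * v $ j)
        = (\<Sum>j<n. mat_mult n V (mat_adj V) (Suc i) (Suc j) * v $ j)"
      by (subst sum.swap) (simp add: mat_mult_def mat_adj_def sum_distrib_right)
    then show "cnj (v $ i) * (\<Sum>l=1..n. \<Sum>j<n. V (Suc i) l * cnj (V (Suc j) l) * v $ j)
        = cnj (v $ i) * (\<Sum>j<n. mat_mult n V (mat_adj V) (Suc i) (Suc j) * v $ j)"
      by (rule arg_cong)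
  qed
  also have "\<dots> = (\<Sum>i<n. e * (v $ i * cnj (v $ i)))"
  proof (rule sum.cong[OF refl])
    fix i assume "i \<in> {..<n}"
    then show "cnj (v $ i) * (\<Sum>j<n. mat_mult n V (mat_adj V) (Suc i) (Suc j) * v $ j) = e * (v $ i * cnj (v $ i))"
      by (subst entry) (auto simp: mult_ac)
  qed
  also have "\<dots> = e * complex_of_real S"
    by (simp add: S_def complex_norm_square sum_distrib_left del: of_real_power)
  finally have eq: "complex_of_real R = e * complex_of_real S" .
  have "\<exists>i<n. v $ i \<noteq> 0" using v(1,2) by (metis carrier_vecD eq_vecI index_zero_vec)
  then have "0 < S" unfolding S_def by (auto intro: sum_pos2)
  moreover have "0 \<le> R" by (simp add: R_def sum_nonneg)
  ultimately show ?thesis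
    using eq by (intro exI[of _ "R / S"]) (simp add: field_simps)
qed

text \<open>By Schur triangularisation the trace of each power is the sum of the powers of the
  diagonal entries of \<open>T\<close>. These are the roots of the characteristic polynomial, hence
  eigenvalues of a positive semidefinite matrix; the same \<open>l\<close> serves all
  exponents.\<close>

lemma ntrace_pow_mult_adjoint:
  fixes V :: "nat \<Rightarrow> nat \<Rightarrow> complex"
  shows "\<exists>l :: nat \<Rightarrow> real. (\<forall>i<n. 0 \<le> l i) \<and>
    (\<forall>r. ntrace n (mat_pow n (mat_mult n V (mat_adj V)) r) = (\<Sum>i<n. complex_of_real (l i) ^ r) / of_nat n)"
proof -
  define M where "M = Matrix.mat n n (\<lambda>(i, j). mat_mult n V (mat_adj V) (Suc i) (Suc j))"
  have M: "M \<in> carrier_mat n n" by (simp add: M_def)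
  obtain es where es: "char_poly M = (\<Prod>a\<leftarrow>es. [:- a, 1:])"
    using char_poly_factorized[OF M] by blast
  obtain T P Q where dec: "schur_decomposition M es = (T, P, Q)" by (cases "schur_decomposition M es")
  have sim: "similar_mat_wit M T P Q" and T: "upper_triangular T" "diag_mat T = es"
    using schur_decomposition[OF M es dec] by auto
  note wit = similar_mat_witD2[OF M sim]
  have trace: "(\<Sum>i<n. (M ^\<^sub>m r) $$ (i, i)) = (\<Sum>i<n. T $$ (i, i) ^ r)" for r
  proof -
    have pow: "T ^\<^sub>m r \<in> carrier_mat n n" using wit(5) by (rule pow_carrier_mat)
    have "(\<Sum>i<n. (M ^\<^sub>m r) $$ (i, i)) = (\<Sum>i<n. (P * (T ^\<^sub>m r * Q)) $$ (i, i))"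
      using similar_mat_wit_pow_id[OF sim, of r] wit pow by (simp add: assoc_mult_mat[of _ n n _ n _ n])
    \<comment> \<open>Cyclicity of the trace moves \<open>P\<close> to the right of
      \<open>Q\<close>, where the two cancel.\<close>
    also have "\<dots> = (\<Sum>i<n. ((T ^\<^sub>m r * Q) * P) $$ (i, i))"
      using wit pow by (intro sum_diag_mult_commute) auto
    also have "(T ^\<^sub>m r * Q) * P = T ^\<^sub>m r"
      using wit pow by (simp add: assoc_mult_mat[of _ n n _ n _ n])
    finally show ?thesis using upper_triangular_pow[OF wit(5) T(1)] by simp
  qed
  have "\<exists>x\<ge>0. T $$ (i, i) = complex_of_real x" if "i < n" for i
  proof -
    have "T $$ (i, i) \<in> set es" using that wit(5) by (auto simp: T(2)[symmetric] diag_mat_def)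
    then have "poly (char_poly M) (T $$ (i, i)) = 0"
      unfolding es by (induction es) auto
    then show ?thesis
      using eigenvalue_mult_adjoint_nonneg[of n V, folded M_def] eigenvalue_root_char_poly[OF M] by blast
  qed
  then obtain l where l: "\<And>i. i < n \<Longrightarrow> 0 \<le> l i \<and> T $$ (i, i) = complex_of_real (l i)" by metis
  have "ntrace n (mat_pow n (mat_mult n V (mat_adj V)) r) = (\<Sum>i<n. complex_of_real (l i) ^ r) / of_nat n" for r
    using trace[of r] l
    by (simp add: ntrace_def sum.atLeast1_atMost_eq mat_pow_eq_pow_mat[symmetric] M_def)
  then show ?thesis using l by blast
qed

section \<open>The moment problem\<close>

text \<open>At every \<open>s\<close>, both characteristic functions are limits of the same Taylor
  sums, because the remainder of order n is at most twice |s|^n / n! times the n-th absolute moment.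
  Only even orders are used, since there the absolute moment is the moment itself.\<close>

lemma char_eq_if_moments_eq:
  assumes M: "real_distribution M" and N: "real_distribution N"
    and intM: "\<And>r. integrable M (\<lambda>t. t ^ r)" and intN: "\<And>r. integrable N (\<lambda>t. t ^ r)"
    and eq: "\<And>r. (\<integral>t. t ^ r \<partial>M) = (\<integral>t. t ^ r \<partial>N)"
    and growth: "\<And>s. (\<lambda>r. s ^ r / fact r * (\<integral>t. t ^ r \<partial>M)) \<longlonglongrightarrow> 0"
  shows "char M = char N"
proof
  fix s
  let ?a = "\<lambda>r. \<integral>t. t ^ r \<partial>M"
  let ?S = "\<lambda>n. \<Sum>j\<le>n. (\<i> * complex_of_real s) ^ j / fact j * complex_of_real (?a j)"
  let ?b = "\<lambda>n. 2 * (\<bar>s\<bar> ^ (2 * n) / fact (2 * n) * ?a (2 * n))"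
  have b0: "?b \<longlonglongrightarrow> 0"
    by (intro tendsto_mult_right_zero LIMSEQ_subseq_LIMSEQ[OF growth, unfolded comp_def, of "\<lambda>n. 2 * n"])
       (simp add: strict_mono_def)
  have conv: "(\<lambda>n. ?S (2 * n)) \<longlonglongrightarrow> char P s"
    if P: "real_distribution P" and int: "\<And>r. integrable P (\<lambda>t. t ^ r)"
      and eqP: "\<And>r. (\<integral>t. t ^ r \<partial>P) = ?a r" for P
  proof -
    interpret real_distribution P by (rule P)
    have "dist (?S (2 * n)) (char P s) \<le> ?b n" for n
      using char_approx1[of "2 * n" s, OF int] eqP
      by (simp add: dist_norm norm_minus_commute power_even_abs)
    then have "(\<lambda>n. dist (?S (2 * n)) (char P s)) \<longlonglongrightarrow> 0"
      by (intro tendsto_sandwich[OF _ _ tendsto_const b0]) auto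
    then show ?thesis by (simp only: tendsto_dist_iff[symmetric])
  qed
  show "char M s = char N s"
    by (rule LIMSEQ_unique[OF conv[OF M intM refl] conv[OF N intN eq[symmetric]]])
qed

text \<open>Markov's inequality for the first moment gives tightness, hence a weakly convergent
  subsequence. Powers are unbounded, so moments are passed to the limit through the truncations
  \<open>min (\<bar>t\<bar> ^ r) c\<close>, whose error is at most a bound on the moment of order
  \<open>2 * r\<close> divided by \<open>c\<close>, uniformly along the sequence.\<close>

lemma moments_tendsto_imp_limit_distribution:
  fixes \<mu> :: "nat \<Rightarrow> real measure" and m :: "nat \<Rightarrow> real"
  assumes rd: "\<And>n. real_distribution (\<mu> n)"
    and int: "\<And>n r. integrable (\<mu> n) (\<lambda>t. t ^ r)"
    and lim: "\<And>r. (\<lambda>n. \<integral>t. t ^ r \<partial>\<mu> n) \<longlonglongrightarrow> m r"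
    and nonneg: "\<And>n. AE t in \<mu> n. 0 \<le> t"
  obtains \<nu> where "real_distribution \<nu>" "AE t in \<nu>. 0 \<le> t"
    "\<And>r. integrable \<nu> (\<lambda>t. t ^ r)" "\<And>r. (\<integral>t. t ^ r \<partial>\<nu>) = m r"
proof -
  interpret \<mu>: real_distribution "\<mu> n" for n by (rule rd)
  have "\<exists>B. \<forall>n. norm (\<integral>t. t ^ r \<partial>\<mu> n) \<le> B" for r
    using convergent_imp_Bseq[OF convergentI[OF lim[of r]]] by (auto simp: Bseq_def)
  then obtain B where B': "\<And>r n. norm (\<integral>t. t ^ r \<partial>\<mu> n) \<le> B r" by metis
  have B: "(\<integral>t. t ^ r \<partial>\<mu> n) \<le> B r" for r n
    by (rule order_trans[OF abs_ge_self]) (use B' in simp)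
  have B0: "0 \<le> B r" for r using norm_ge_zero B' order_trans by blast
  have tail: "measure (\<mu> n) {t. c \<le> t} \<le> B 1 / c" if "0 < c" for c n
  proof -
    have "measure (\<mu> n) {t \<in> space (\<mu> n). c \<le> t} \<le> (\<integral>t. t \<partial>\<mu> n) / c"
      using int[of n 1] nonneg that by (intro integral_Markov_inequality_measure[where A = "{}"]) auto
    also have "\<dots> \<le> B 1 / c" using B[of n 1] that by (intro divide_right_mono) auto
    finally show ?thesis by simp
  qed
  have tight: "tight \<mu>"
    unfolding tight_def
  proof (intro conjI allI impI rd)
    fix \<epsilon> :: real assume \<epsilon>: "0 < \<epsilon>"
    \<comment> \<open>Large enough for the tail bound \<open>B 1 / c\<close> to fall below
      \<open>\<epsilon>\<close>; the summands 1 give strictness and keep \<open>c\<close>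
      positive.\<close>
    define c where "c = (B 1 + 1) / \<epsilon> + 1"
    have c: "0 < c" "B 1 / c < \<epsilon>"
    proof -
      have "0 < (B 1 + 1) / \<epsilon>" using B0[of 1] \<epsilon> by (intro divide_pos_pos) auto
      then show "0 < c" by (simp add: c_def)
      have "B 1 < (c - 1) * \<epsilon>" using \<epsilon> by (simp add: c_def)
      also have "\<dots> < c * \<epsilon>" using \<epsilon> by simp
      finally show "B 1 / c < \<epsilon>" using \<open>0 < c\<close> by (simp add: field_simps)
    qed
    \<comment> \<open>The left endpoint is negative because the interval is open on the left while 0
      may carry mass.\<close>
    have "1 - \<epsilon> < measure (\<mu> n) {-1<..c}" for n
    proof -
      have "measure (\<mu> n) (UNIV - {-1<..c}) \<le> measure (\<mu> n) {t. c \<le> t}"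
        using nonneg[of n] by (intro \<mu>.finite_measure_mono_AE) auto
      also have "\<dots> < \<epsilon>" using tail[OF c(1), of n] c(2) by simp
      finally show ?thesis using \<mu>.prob_compl[of "{-1<..c}" n] by simp
    qed
    then show "\<exists>a b. a < b \<and> (\<forall>n. 1 - \<epsilon> < measure (\<mu> n) {a<..b})"
      using c(1) by (intro exI[of _ "-1"] exI[of _ c]) auto
  qed
  obtain s \<nu> where s: "strict_mono (s :: nat \<Rightarrow> nat)" and \<nu>: "real_distribution \<nu>"
    and weak: "weak_conv_m (\<mu> \<circ> id \<circ> s) \<nu>"
    using tight_imp_convergent_subsubsequence[OF tight, of id] by (auto simp: strict_mono_def)
  interpret \<nu>: real_distribution \<nu> by (rule \<nu>)
  have cont_lim: "(\<lambda>n. \<integral>t. f t \<partial>\<mu> (s n)) \<longlonglongrightarrow> (\<integral>t. f t \<partial>\<nu>)"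
    if "continuous_on UNIV f" "\<And>t. \<bar>f t\<bar> \<le> C" for f :: "real \<Rightarrow> real" and C
    using that by (intro weak_conv_imp_integral_bdd_continuous_conv[OF rd \<nu>, of "\<lambda>n. s n", where B = C])
       (use weak in \<open>auto simp: comp_def continuous_on_eq_continuous_at\<close>)
  have AE_nonneg: "AE t in \<nu>. 0 \<le> t"
  proof -
    \<comment> \<open>A bounded continuous test function that is positive exactly on the negative
      half-line; its vanishing integral passes to the weak limit.\<close>
    let ?f = "\<lambda>t::real. min 1 (max 0 (- t))"
    have "(\<integral>t. ?f t \<partial>\<mu> n) = 0" for n
      using nonneg[of n] by (intro integral_eq_zero_AE) auto
    then have "(\<lambda>n. 0) \<longlonglongrightarrow> (\<integral>t. ?f t \<partial>\<nu>)"
      using cont_lim[of ?f 1] by (simp add: continuous_intros)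
    then have "(\<integral>t. ?f t \<partial>\<nu>) = 0" by (simp add: LIMSEQ_const_iff)
    moreover have "integrable \<nu> ?f" by (intro \<nu>.integrable_const_bound[where B = 1]) auto
    ultimately have "AE t in \<nu>. ?f t = 0" by (subst (asm) integral_nonneg_eq_0_iff_AE) auto
    then show ?thesis by eventually_elim (auto simp: min_def max_def split: if_splits)
  qed
  have trunc_lim: "(\<lambda>n. \<integral>t. min (\<bar>t\<bar> ^ r) c \<partial>\<mu> (s n)) \<longlonglongrightarrow> (\<integral>t. min (\<bar>t\<bar> ^ r) c \<partial>\<nu>)"
    if "0 \<le> c" for r c
    using that by (intro cont_lim[of _ c]) (auto intro!: continuous_intros)
  \<comment> \<open>Even powers are nonnegative, so monotone convergence of the truncations at
    height \<open>i\<close> gives integrability and carries the uniform bound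
    \<open>B (2 * r)\<close> over to \<open>\<nu>\<close>.\<close>
  have even_moment: "integrable \<nu> (\<lambda>t. t ^ (2 * r)) \<and> (\<integral>t. t ^ (2 * r) \<partial>\<nu>) \<le> B (2 * r)" for r
  proof -
    define h where "h i t = min (\<bar>t\<bar> ^ (2 * r)) (real i)" for i and t :: real
    have int_h: "integrable \<nu> (h i)" for i
      unfolding h_def by (intro \<nu>.integrable_const_bound[where B = "real i"]) auto
    have h_le: "(\<integral>t. h i t \<partial>\<nu>) \<le> B (2 * r)" for i
    proof (rule LIMSEQ_le_const2)
      show "(\<lambda>n. \<integral>t. h i t \<partial>\<mu> (s n)) \<longlonglongrightarrow> (\<integral>t. h i t \<partial>\<nu>)"
        unfolding h_def by (rule trunc_lim) simp
      have "(\<integral>t. h i t \<partial>\<mu> n) \<le> B (2 * r)" for n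
      proof -
        have "(\<integral>t. h i t \<partial>\<mu> n) \<le> (\<integral>t. t ^ (2 * r) \<partial>\<mu> n)"
          by (intro integral_mono int)
             (auto simp: h_def power_even_abs intro!: \<mu>.integrable_const_bound[where B = "real i"])
        then show ?thesis using B[of n "2 * r"] by simp
      qed
      then show "\<exists>N. \<forall>n\<ge>N. (\<integral>t. h i t \<partial>\<mu> (s n)) \<le> B (2 * r)" by blast
    qed
    have "incseq (\<lambda>i. \<integral>t. h i t \<partial>\<nu>)"
      by (intro incseq_SucI integral_mono int_h) (auto simp: h_def)
    then obtain x where x: "(\<lambda>i. \<integral>t. h i t \<partial>\<nu>) \<longlonglongrightarrow> x" using incseq_convergent h_le by blast
    have "(\<lambda>i. h i t) \<longlonglongrightarrow> t ^ (2 * r)" for t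
    proof (rule tendsto_eventually)
      obtain i0 :: nat where "\<bar>t\<bar> ^ (2 * r) \<le> real i0" using real_arch_simple by blast
      then have "h i t = t ^ (2 * r)" if "i0 \<le> i" for i
        using that by (simp add: h_def power_even_abs)
      then show "\<forall>\<^sub>F i in sequentially. h i t = t ^ (2 * r)"
        unfolding eventually_sequentially by blast
    qed
    then have lim_h: "AE t in \<nu>. (\<lambda>i. h i t) \<longlonglongrightarrow> t ^ (2 * r)" by simp
    have mono_h: "AE t in \<nu>. mono (\<lambda>i. h i t)" by (auto simp: mono_def h_def)
    have "integrable \<nu> (\<lambda>t. t ^ (2 * r))" "(\<integral>t. t ^ (2 * r) \<partial>\<nu>) = x"
      using integrable_monotone_convergence[OF int_h mono_h lim_h x]
        integral_monotone_convergence[OF int_h mono_h lim_h x] by auto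
    moreover have "x \<le> B (2 * r)" using h_le by (intro LIMSEQ_le_const2[OF x]) auto
    ultimately show ?thesis by simp
  qed
  \<comment> \<open>An arbitrary power is dominated by 1 plus its square, which is an even
    power.\<close>
  have int_\<nu>: "integrable \<nu> (\<lambda>t. t ^ r)" for r
  proof (rule Bochner_Integration.integrable_bound)
    show "integrable \<nu> (\<lambda>t. 1 + t ^ (2 * r))" using even_moment by simp
    have "\<bar>t ^ r\<bar> \<le> 1 + t ^ (2 * r)" for t :: real
    proof -
      have "\<bar>x\<bar> \<le> 1 + x\<^sup>2" for x :: real
        by (cases "\<bar>x\<bar> \<le> 1") (use abs_le_square_iff[of 1 x] self_le_power[of "\<bar>x\<bar>" 2] in \<open>auto intro: add_increasing2\<close>)
      then show ?thesis by (simp add: power_even_eq)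
    qed
    then show "AE t in \<nu>. norm (t ^ r) \<le> norm (1 + t ^ (2 * r))"
      by (intro always_eventually allI) (metis abs_ge_self order_trans real_norm_def)
  qed simp
  \<comment> \<open>The truncation error of x = t^r vanishes for x \<le> c and is otherwise at most
    x \<le> x^2 / c. The estimate is uniform over all measures that obey the bound on the moment of
    order \<open>2 * r\<close>.\<close>
  have trunc: "\<bar>(\<integral>t. t ^ r \<partial>P) - (\<integral>t. min (\<bar>t\<bar> ^ r) c \<partial>P)\<bar> \<le> B (2 * r) / c"
    if P: "real_distribution P" "AE t in P. 0 \<le> t" "\<And>r. integrable P (\<lambda>t. t ^ r)"
      "(\<integral>t. t ^ (2 * r) \<partial>P) \<le> B (2 * r)" and c: "0 < c" for P r c
  proof -
    interpret P: real_distribution P by fact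
    have int_min: "integrable P (\<lambda>t. min (\<bar>t\<bar> ^ r) c)"
      using c by (intro P.integrable_const_bound[where B = c]) auto
    have pw: "\<bar>x - min x c\<bar> \<le> x\<^sup>2 / c" if "0 \<le> x" for x :: real
    proof (cases "x \<le> c")
      case False
      then have "x * c \<le> x * x" using that by (intro mult_left_mono) auto
      then have "x \<le> x\<^sup>2 / c" using c by (simp add: field_simps power2_eq_square)
      then show ?thesis using False c by (simp add: min_def)
    qed (use c in simp)
    have "(\<integral>t. t ^ r \<partial>P) - (\<integral>t. min (\<bar>t\<bar> ^ r) c \<partial>P) = (\<integral>t. t ^ r - min (\<bar>t\<bar> ^ r) c \<partial>P)"
      using int_min P(3) by simp
    also have "\<bar>\<dots>\<bar> \<le> (\<integral>t. \<bar>t ^ r - min (\<bar>t\<bar> ^ r) c\<bar> \<partial>P)" by (rule integral_abs_bound)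
    also have "\<dots> \<le> (\<integral>t. t ^ (2 * r) / c \<partial>P)"
    proof (rule integral_mono_AE)
      show "AE t in P. \<bar>t ^ r - min (\<bar>t\<bar> ^ r) c\<bar> \<le> t ^ (2 * r) / c"
        using P(2)
      proof eventually_elim
        case (elim t)
        then show ?case using pw[of "t ^ r"] by (simp add: power_even_eq)
      qed
    qed (use int_min P(3) in auto)
    also have "\<dots> \<le> B (2 * r) / c" using P(4) c by (simp add: divide_right_mono)
    finally show ?thesis .
  qed
  have "(\<integral>t. t ^ r \<partial>\<nu>) = m r" for r
  proof (rule ccontr)
    let ?a = "\<integral>t. t ^ r \<partial>\<nu>"
    assume "?a \<noteq> m r"
    then have d: "0 < \<bar>m r - ?a\<bar>" by simp
    \<comment> \<open>With this cut-off the two truncation errors together stay below the supposed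
      gap; the summand 1 makes the inequality strict and \<open>c\<close> positive.\<close>
    define c where "c = (2 * B (2 * r) + 1) / \<bar>m r - ?a\<bar>"
    have c: "0 < c" using d B0[of "2 * r"] by (auto simp: c_def intro!: divide_pos_pos)
    have "(\<lambda>n. \<bar>(\<integral>t. t ^ r \<partial>\<mu> (s n)) - (\<integral>t. min (\<bar>t\<bar> ^ r) c \<partial>\<mu> (s n))\<bar>)
        \<longlonglongrightarrow> \<bar>m r - (\<integral>t. min (\<bar>t\<bar> ^ r) c \<partial>\<nu>)\<bar>"
      using LIMSEQ_subseq_LIMSEQ[OF lim[of r] s] trunc_lim[of c r] c
      by (intro tendsto_rabs tendsto_diff) (auto simp: comp_def)
    then have "\<bar>m r - (\<integral>t. min (\<bar>t\<bar> ^ r) c \<partial>\<nu>)\<bar> \<le> B (2 * r) / c"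
      by (rule LIMSEQ_le_const2) (intro exI[of _ 0] allI impI trunc rd nonneg int B c)
    moreover have "\<bar>?a - (\<integral>t. min (\<bar>t\<bar> ^ r) c \<partial>\<nu>)\<bar> \<le> B (2 * r) / c"
      using even_moment by (intro trunc \<nu> AE_nonneg int_\<nu> c) auto
    ultimately have "\<bar>m r - ?a\<bar> \<le> 2 * B (2 * r) / c" by simp
    also have "\<dots> = \<bar>m r - ?a\<bar> * (2 * B (2 * r) / (2 * B (2 * r) + 1))" by (simp add: c_def)
    also have "\<dots> < \<bar>m r - ?a\<bar> * 1"
      using d B0[of "2 * r"] by (intro mult_strict_left_mono) auto
    finally show False by simp
  qed
  then show ?thesis using that[of \<nu>] \<nu> AE_nonneg int_\<nu> by blast
qed

section \<open>Limit moments\<close>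

lemma inj_on_if_increasing:
  fixes k :: "nat \<Rightarrow> nat"
  assumes "\<And>p q. 1 \<le> p \<Longrightarrow> p < q \<Longrightarrow> k p < k q"
  shows "inj_on k {1..N}"
proof (rule linorder_inj_onI')
  fix p q assume "p \<in> {1..N}" "q \<in> {1..N}" "p < q"
  then have "k p < k q" using assms[of p q] by simp
  then show "k p \<noteq> k q" by simp
qed

lemma K_seq_bounds:
  assumes "inj_on k {1..N}" "1 \<le> r" "\<rho> \<in> partitions r"
  shows "0 \<le> K_seq k r \<rho> N" "K_seq k r \<rho> N \<le> 1"
proof -
  show "0 \<le> K_seq k r \<rho> N" by (simp add: K_seq_def)
  have "real (card (S_set k r \<rho> N)) \<le> real N ^ (r + 1 - card \<rho>)"
    using card_S_set_le[OF assms] by (metis of_nat_le_iff of_nat_power)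
  then show "K_seq k r \<rho> N \<le> 1"
    unfolding K_seq_def by (intro divide_le_eq_1[THEN iffD2]) (auto simp: not_less)
qed

text \<open>The power N^(r+1) splits into N^|\<rho>|, whose ratio with the falling factorial tends
  to 1, and N^(r+1-|\<rho>|), which turns the number of solutions into \<open>K_seq\<close>.\<close>

lemma moment_sum_tendsto:
  assumes r: "1 \<le> r" and conv: "\<And>\<rho>. \<rho> \<in> partitions r \<Longrightarrow> convergent (K_seq k r \<rho>)"
  shows "(\<lambda>N. moment_sum k N r) \<longlonglongrightarrow> (\<Sum>\<rho>\<in>partitions r. K_lim k r \<rho>)"
proof -
  have ratio: "(\<lambda>N. \<Prod>i<b. real (N - i) / real N) \<longlonglongrightarrow> 1" for b
  proof -
    have "(\<lambda>N. real (N - i) / real N) \<longlonglongrightarrow> 1" for i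
    proof (rule Lim_transform_eventually)
      show "(\<lambda>N. 1 - real i / real N) \<longlonglongrightarrow> 1"
        using tendsto_diff[OF tendsto_const lim_const_over_n, of 1 "real i"] by simp
      show "\<forall>\<^sub>F N in sequentially. 1 - real i / real N = real (N - i) / real N"
        using eventually_ge_at_top[of "Suc i"] by eventually_elim (simp add: of_nat_diff field_simps)
    qed
    then show ?thesis using tendsto_prod[of "{..<b}" "\<lambda>i N. real (N - i) / real N" "\<lambda>_. 1"] by simp
  qed
  have "(\<lambda>N. \<Sum>\<rho>\<in>partitions r. (\<Prod>i<card \<rho>. real (N - i) / real N) * K_seq k r \<rho> N)
      \<longlonglongrightarrow> (\<Sum>\<rho>\<in>partitions r. 1 * K_lim k r \<rho>)"
    using conv by (intro tendsto_sum tendsto_mult ratio) (simp add: K_lim_def convergent_LIMSEQ_iff)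
  moreover have "(\<Sum>\<rho>\<in>partitions r. (\<Prod>i<card \<rho>. real (N - i) / real N) * K_seq k r \<rho> N) = moment_sum k N r"
    if "0 < N" for N
  proof -
    have "(\<Prod>i<card \<rho>. real (N - i) / real N) * K_seq k r \<rho> N
        = real (\<Prod>i<card \<rho>. N - i) * real (card (S_set k r \<rho> N)) / real N ^ Suc r"
      if \<rho>: "\<rho> \<in> partitions r" for \<rho>
    proof -
      have "real N ^ Suc r = real N ^ card \<rho> * real N ^ (r + 1 - card \<rho>)"
        using card_le_if_in_partitions[OF \<rho>] by (simp flip: power_add power_Suc)
      then show ?thesis by (simp add: K_seq_def prod_dividef)
    qed
    then show ?thesis using r by (simp add: moment_sum_def sum_divide_distrib)
  qed
  ultimately show ?thesis
    by (auto elim!: Lim_transform_eventually intro!: eventually_mono[OF eventually_gt_at_top[of 0]])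
qed

lemma expected_moment_eq_moment_sum:
  assumes "1 \<le> N"
  shows "expected_moment k N r = complex_of_real (moment_sum k N r)"
  unfolding expected_moment_def
\<comment> \<open>The degree bound is still schematic at this point; it is settled at the end as one
  more than \<open>r\<close> times the sum of all \<open>k p\<close>.\<close>
proof (rule char_orthogonal_ntrace_pow[OF char_orthogonal_theta_law assms])
  fix p assume "p \<in> {1..N}"
  then have "k p \<le> (\<Sum>p\<in>{1..N}. k p)" by (intro member_le_sum) auto
  then show "r * k p < Suc (r * (\<Sum>p\<in>{1..N}. k p))" by (simp add: less_Suc_eq_le)
qed

text \<open>The measure is the average over the grid of the spectral distributions of the matrices.
  On a finite grid the eigenvalues may be chosen arbitrarily for each phase vector, so no question
  of measurable dependence on the phases arises.\<close>

lemma exists_distribution_with_moment_sums: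
  assumes N: "1 \<le> N"
  shows "\<exists>\<mu>. real_distribution \<mu> \<and> (\<forall>r. integrable \<mu> (\<lambda>t. t ^ r)) \<and> (AE t in \<mu>. 0 \<le> t) \<and>
    (\<forall>r\<le>N. (\<integral>t. t ^ r \<partial>\<mu>) = moment_sum k N r)"
proof -
  \<comment> \<open>So fine a grid that, for all \<open>r \<le> N\<close>, every exponent in the
    r-th moment lies below \<open>M\<close>.\<close>
  define M where "M = Suc (N * (\<Sum>p\<in>{1..N}. k p))"
  have M: "0 < M" by (simp add: M_def)
  have "\<exists>l :: nat \<Rightarrow> real. (\<forall>i<N. 0 \<le> l i) \<and>
    (\<forall>r. ntrace N (mat_pow N (vandermonde_X k N \<theta>) r) = (\<Sum>i<N. complex_of_real (l i) ^ r) / of_nat N)" for \<theta>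
    unfolding vandermonde_X_def by (rule ntrace_pow_mult_adjoint)
  then obtain l :: "(nat \<Rightarrow> real) \<Rightarrow> nat \<Rightarrow> real" where l0: "\<And>\<theta> i. i < N \<Longrightarrow> 0 \<le> l \<theta> i"
    and l: "\<And>\<theta> r. ntrace N (mat_pow N (vandermonde_X k N \<theta>) r) = (\<Sum>i<N. complex_of_real (l \<theta> i) ^ r) / of_nat N"
    by metis
  define G where "G = {1..N} \<rightarrow>\<^sub>E {..<M}"
  \<comment> \<open>A uniformly random element of \<open>J\<close> picks a grid point and the index
    of an eigenvalue; \<open>x\<close> is that eigenvalue.\<close>
  define J where "J = G \<times> {..<N}"
  define x where "x j = l (grid_point M (fst j)) (snd j)" for j
  have finG: "finite G" unfolding G_def by (intro finite_PiE) auto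
  have cardG: "card G = M ^ N" by (simp add: G_def card_funcsetE)
  have finJ: "finite J" using finG by (simp add: J_def)
  have cardJ: "card J = M ^ N * N" by (simp add: J_def cardG card_cartesian_product)
  then have J: "J \<noteq> {}" using M N by auto
  have avg: "(\<Sum>j\<in>J. x j ^ r) / card J = moment_sum k N r" if r: "r \<le> N" for r
  proof -
    have "complex_of_real (moment_sum k N r)
        = (\<Sum>g\<in>G. ntrace N (mat_pow N (vandermonde_X k N (grid_point M g)) r)) / of_nat M ^ N"
      unfolding G_def
    proof (rule char_orthogonal_ntrace_pow[OF char_orthogonal_grid[OF M] N, symmetric])
      fix p assume "p \<in> {1..N}"
      then have "k p \<le> (\<Sum>p\<in>{1..N}. k p)" by (intro member_le_sum) auto
      then show "r * k p < M" unfolding M_def less_Suc_eq_le by (intro mult_le_mono r)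
    qed
    also have "\<dots> = (\<Sum>g\<in>G. \<Sum>i<N. complex_of_real (l (grid_point M g) i) ^ r) / of_nat (card J)"
      by (simp add: l cardJ flip: sum_divide_distrib)
    also have "(\<Sum>g\<in>G. \<Sum>i<N. complex_of_real (l (grid_point M g) i) ^ r) = complex_of_real (\<Sum>j\<in>J. x j ^ r)"
      by (simp add: J_def x_def sum.cartesian_product case_prod_unfold)
    also have "\<dots> / of_nat (card J) = complex_of_real ((\<Sum>j\<in>J. x j ^ r) / card J)" by simp
    finally show ?thesis by (simp only: of_real_eq_iff)
  qed
  let ?P = "measure_pmf (pmf_of_set J)"
  let ?\<mu> = "distr ?P borel x"
  have "real_distribution ?\<mu>" by (rule prob_space.real_distribution_distr[OF prob_space_measure_pmf]) simp
  moreover have "integrable ?\<mu> (\<lambda>t. t ^ r)" for r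
    using finJ J by (subst integrable_distr_eq) (simp_all add: integrable_measure_pmf_finite)
  moreover have "AE t in ?\<mu>. 0 \<le> t"
    using finJ J l0 by (subst AE_distr_iff) (auto simp: AE_measure_pmf_iff J_def x_def)
  moreover have "(\<integral>t. t ^ r \<partial>?\<mu>) = moment_sum k N r" if "r \<le> N" for r
    using avg[OF that] finJ J by (subst integral_distr) (auto simp: integral_pmf_of_set)
  ultimately show ?thesis by blast
qed

theorem mainTheorem17:
  fixes k :: "nat \<Rightarrow> nat"
  assumes incr: "\<And>p q. 1 \<le> p \<Longrightarrow> p < q \<Longrightarrow> k p < k q"
    and pos: "\<And>p. 1 \<le> p \<Longrightarrow> 0 < k p"
    and lim_ex: "\<And>r \<rho>. 1 \<le> r \<Longrightarrow> \<rho> \<in> partitions r \<Longrightarrow> convergent (K_seq k r \<rho>)"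
  shows "(\<forall>r \<ge> 1. \<forall>\<rho> \<in> partitions r. 0 \<le> K_lim k r \<rho> \<and> K_lim k r \<rho> \<le> 1)
    \<and> (\<exists>m :: nat \<Rightarrow> real.
         (\<forall>r. (\<lambda>N. expected_moment k N r) \<longlonglongrightarrow> complex_of_real (m r))
       \<and> (\<forall>r \<ge> 1. m r = (\<Sum>\<rho> \<in> partitions r. K_lim k r \<rho>))
       \<and> (\<exists>!\<mu> :: real measure. prob_space \<mu> \<and> sets \<mu> = sets borel
            \<and> emeasure \<mu> {0..} = 1
            \<and> (\<forall>r. integrable \<mu> (\<lambda>t. t ^ r) \<and> m r = (\<integral>t. t ^ r \<partial>\<mu>))))"
proof -
  have K_bounds: "0 \<le> K_lim k r \<rho> \<and> K_lim k r \<rho> \<le> 1" if "1 \<le> r" "\<rho> \<in> partitions r" for r \<rho>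
  proof -
    have "K_seq k r \<rho> \<longlonglongrightarrow> K_lim k r \<rho>"
      using lim_ex[OF that] by (simp add: K_lim_def convergent_LIMSEQ_iff)
    moreover note K_seq_bounds[OF inj_on_if_increasing that] incr
    ultimately show ?thesis by (meson LIMSEQ_le_const LIMSEQ_le_const2)
  qed
  \<comment> \<open>At \<open>r = 0\<close> the sum over partitions would give the limit of 1/N,
    which is 0, so the total mass 1 is set separately.\<close>
  define m where "m r = (if r = 0 then 1 else \<Sum>\<rho>\<in>partitions r. K_lim k r \<rho>)" for r
  have m_lim: "(\<lambda>N. moment_sum k N r) \<longlonglongrightarrow> m r" for r
    using moment_sum_tendsto[of r k] lim_ex[of r] by (cases "r = 0") (auto simp: m_def moment_sum_def)
  have moments: "(\<lambda>N. expected_moment k N r) \<longlonglongrightarrow> complex_of_real (m r)" for r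
  proof (rule Lim_transform_eventually)
    show "(\<lambda>N. complex_of_real (moment_sum k N r)) \<longlonglongrightarrow> complex_of_real (m r)"
      by (intro tendsto_of_real m_lim)
    show "\<forall>\<^sub>F N in sequentially. complex_of_real (moment_sum k N r) = expected_moment k N r"
      using eventually_ge_at_top[of 1] by eventually_elim (simp add: expected_moment_eq_moment_sum)
  qed
  have growth: "(\<lambda>r. s ^ r / fact r * m r) \<longlonglongrightarrow> 0" for s :: real
  proof -
    \<comment> \<open>This choice makes |s| / t less than 1/2, so the bound on the Bell numbers at
      \<open>t\<close> yields a geometric majorant at \<open>s\<close>.\<close>
    define t where "t = 2 * \<bar>s\<bar> + 1"
    have t: "0 < t" "\<bar>s\<bar> / t < 1" by (auto simp: t_def field_simps)
    have bound: "norm (s ^ r / fact r * m r) \<le> exp (exp t) * (\<bar>s\<bar> / t) ^ r" if r: "1 \<le> r" for r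
    proof -
      have "0 \<le> m r" using K_bounds r by (auto simp: m_def intro!: sum_nonneg)
      moreover have "m r \<le> real (card (partitions r))"
        using K_bounds r sum_bounded_above[of "partitions r" "K_lim k r" 1] by (simp add: m_def)
      ultimately have "norm (s ^ r / fact r * m r) \<le> \<bar>s\<bar> ^ r / fact r * real (card (partitions r))"
        by (simp add: abs_mult power_abs mult_left_mono divide_right_mono)
      also have "\<dots> = (real (card (partitions r)) * t ^ r / fact r) * (\<bar>s\<bar> / t) ^ r"
        using t(1) by (simp add: power_divide)
      also have "\<dots> \<le> exp (exp t) * (\<bar>s\<bar> / t) ^ r"
        using card_partitions_le[OF t(1)] t(1) by (intro mult_right_mono) auto
      finally show ?thesis .
    qed
    have "(\<lambda>r. exp (exp t) * (\<bar>s\<bar> / t) ^ r) \<longlonglongrightarrow> 0"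
      using t by (intro tendsto_mult_right_zero LIMSEQ_power_zero) simp
    then show ?thesis
    proof (rule Lim_null_comparison[rotated])
      show "\<forall>\<^sub>F r in sequentially. norm (s ^ r / fact r * m r) \<le> exp (exp t) * (\<bar>s\<bar> / t) ^ r"
        using eventually_ge_at_top[of 1] by (rule eventually_mono) (rule bound)
    qed
  qed
  \<comment> \<open>The shift by \<open>Suc\<close> excludes the matrix size 0. For fixed
    \<open>r\<close> the moments of \<open>\<mu> n\<close> are the exact ones as soon as
    \<open>n \<ge> r\<close>, which suffices for the limit.\<close>
  obtain \<mu> where \<mu>: "\<And>n. real_distribution (\<mu> n)" "\<And>n r. integrable (\<mu> n) (\<lambda>t. t ^ r)"
      "\<And>n. AE t in \<mu> n. 0 \<le> t" "\<And>n r. r \<le> Suc n \<Longrightarrow> (\<integral>t. t ^ r \<partial>\<mu> n) = moment_sum k (Suc n) r"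
    using exists_distribution_with_moment_sums[of "Suc _" k] by (simp add: choice_iff) metis
  have \<mu>_lim: "(\<lambda>n. \<integral>t. t ^ r \<partial>\<mu> n) \<longlonglongrightarrow> m r" for r
  proof (rule Lim_transform_eventually)
    show "(\<lambda>n. moment_sum k (Suc n) r) \<longlonglongrightarrow> m r" by (rule LIMSEQ_Suc[OF m_lim])
    show "\<forall>\<^sub>F n in sequentially. moment_sum k (Suc n) r = (\<integral>t. t ^ r \<partial>\<mu> n)"
      using eventually_ge_at_top[of r] by eventually_elim (simp add: \<mu>(4))
  qed
  obtain \<nu> where \<nu>: "real_distribution \<nu>" "AE t in \<nu>. 0 \<le> t"
    "\<And>r. integrable \<nu> (\<lambda>t. t ^ r)" "\<And>r. (\<integral>t. t ^ r \<partial>\<nu>) = m r"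
    using moments_tendsto_imp_limit_distribution[OF \<mu>(1,2) \<mu>_lim \<mu>(3)] by blast
  interpret \<nu>: real_distribution \<nu> by (rule \<nu>)
  have "\<exists>!\<mu> :: real measure. prob_space \<mu> \<and> sets \<mu> = sets borel \<and> emeasure \<mu> {0..} = 1
      \<and> (\<forall>r. integrable \<mu> (\<lambda>t. t ^ r) \<and> m r = (\<integral>t. t ^ r \<partial>\<mu>))"
  proof (rule ex1I[of _ \<nu>])
    have "emeasure \<nu> {0..} = 1" using \<nu>(2) by (intro \<nu>.emeasure_eq_1_AE) auto
    then show "prob_space \<nu> \<and> sets \<nu> = sets borel \<and> emeasure \<nu> {0..} = 1
        \<and> (\<forall>r. integrable \<nu> (\<lambda>t. t ^ r) \<and> m r = (\<integral>t. t ^ r \<partial>\<nu>))"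
      using \<nu> \<nu>.prob_space_axioms by simp
  next
    fix \<xi> :: "real measure"
    assume \<xi>: "prob_space \<xi> \<and> sets \<xi> = sets borel \<and> emeasure \<xi> {0..} = 1
        \<and> (\<forall>r. integrable \<xi> (\<lambda>t. t ^ r) \<and> m r = (\<integral>t. t ^ r \<partial>\<xi>))"
    then have rd: "real_distribution \<xi>"
      by (simp add: real_distribution_def real_distribution_axioms_def)
    \<comment> \<open>Any competitor \<open>\<xi>\<close> has the moments \<open>m\<close> and hence
      inherits their growth bound; equality of the characteristic functions then gives equality of
      the measures.\<close>
    have "char \<xi> = char \<nu>"
    proof (rule char_eq_if_moments_eq[OF rd \<nu>(1)])
      show "(\<lambda>r. s ^ r / fact r * (\<integral>t. t ^ r \<partial>\<xi>)) \<longlonglongrightarrow> 0" for s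
        using growth[of s] \<xi> by simp
    qed (use \<xi> \<nu> in auto)
    then show "\<xi> = \<nu>" by (rule Levy_uniqueness[OF rd \<nu>(1)])
  qed
  then show ?thesis using K_bounds moments by (intro conjI exI[of _ m]) (auto simp: m_def)
qed

end
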